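(* Let $D$ be a defeasible theory, let $S_D$ and $S^*_D$ be the compiled programs of $D$ described in the context, and let $q(\vec a)$ be a ground literal of $D$. Then: (1) $D\vdash +\Delta\, q(\vec a)$ iff $S_D\models_{WF}\mathtt{definitely\_q}(\vec a)$; (2) $D\vdash +\lambda\, q(\vec a)$ iff $S_D\models_{WF}\mathtt{lambda\_q}(\vec a)$; (3) $D\vdash +\partial_{||}\, q(\vec a)$ iff $S_D\models_{WF}\mathtt{defeasibly\_q}(\vec a)$; (4) $D\vdash +\partial^*_{||}\, q(\vec a)$ iff $S^*_D\models_{WF}\mathtt{defeasibly\_q}(\vec a)$.
   Context: Defeasible theories. Terms are built from variables, constants and function symbols. A literal is an atom $p(t_1,\dots,t_n)$ or its classical negation $\neg p(t_1,\dots,t_n)$; ${\sim}q$ denotes the complementary literal of $q$. A defeasible theory is a triple $D=(F,R,>)$ where $F$ is a finite set of variable-free literals (facts); $R$ is a finite set of rules, each having a distinct label $r$, a finite set of literals $A(r)$ (antecedent), a literal $C(r)$ (consequent) and a kind: strict ($A(r)\to C(r)$), defeasible ($A(r)\Rightarrow C(r)$) or defeater ($A(r)\leadsto C(r)$); and $>$ is an acyclic binary relation on rule labels (superiority). $R_s$ is the set of strict rules, $R_{sd}$ the set of strict or defeasible rules, $R[q]$ the set of rules with consequent $q$. A non-ground theory is identified with the theory of all ground instances of its rules, and the following definitions are applied to it. $P_\Delta$ is the least set of ground literals such that $q\in P_\Delta$ whenever $q\in F$ or some $r\in R_s[q]$ has $A(r)\subseteq P_\Delta$. $P_\lambda$ is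 the least set such that $q\in P_\lambda$ whenever $q\in P_\Delta$, or some $r\in R_{sd}[q]$ has $A(r)\subseteq P_\lambda$ and ${\sim}q\notin P_\Delta$. $P_{\partial_{||}}$ is the least set $X$ such that $q\in X$ whenever $q\in P_\Delta$, or: (2.1) some $r\in R_{sd}[q]$ has $A(r)\subseteq X$, (2.2) ${\sim}q\notin P_\Delta$, and (2.3) for every $s\in R[{\sim}q]$, either some $\alpha\in A(s)$ has $\alpha\notin P_\lambda$, or some $t\in R_{sd}[q]$ has $A(t)\subseteq X$ and $t>s$. $P_{\partial^*_{||}}$ is defined identically except that the second alternative of (2.3) is replaced by "$r>s$", where $r$ is the rule of (2.1). $D\vdash+\Delta q$, $D\vdash+\lambda q$, $D\vdash+\partial_{||}q$, $D\vdash+\partial^*_{||}q$ mean $q\in P_\Delta$, $q\in P_\lambda$, $q\in P_{\partial_{||}}$, $q\in P_{\partial^*_{||}}$ respectively. Compiled program $S_D$. For a literal $q$ with predicate $p$, $\mathtt{q}$ denotes the name $\mathtt{p}$ if $q$ is positive and $\mathtt{not\_p}$ if $q=\neg p(\dots)$; $\mathtt{{\sim}q}$ denotes the name of the complementary literal; $\vec a$ is the argument tuple of $q(\vec a)$. Predicate names such as $\mathtt{definitely\_q}$ are formed by concatenation. $S_D$ consists exactly of: (i) for each fact $q(\vec a)\in F$, the unit clauses $\mathtt{definitely\_q}(\vec a)$, $\mathtt{lambda\_q}(\vec a)$, $\mathtt{defeasibly\_q}(\vec a)$; (ii) for each strict rule $r: q_1(\vec a_1),\dots,q_n(\vec a_n)\to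 q(\vec a)$: $\mathtt{definitely\_q}(\vec a) \,\text{:-}\, \mathtt{body}^\Delta_r(\vec a)$; $\mathtt{lambda\_q}(\vec a)\,\text{:-}\,\mathtt{body}^\Delta_r(\vec a)$; $\mathtt{defeasibly\_q}(\vec a)\,\text{:-}\,\mathtt{body}^\Delta_r(\vec a)$; $\mathtt{body}^\Delta_r(\vec a)\,\text{:-}\,\mathtt{definitely\_q_1}(\vec a_1),\dots,\mathtt{definitely\_q_n}(\vec a_n)$; (iii) for each strict or defeasible rule $r: q_1(\vec a_1),\dots,q_n(\vec a_n)\hookrightarrow q(\vec a)$: $\mathtt{lambda\_q}(\vec a)\,\text{:-}\,not\ \mathtt{definitely\_{\sim}q}(\vec a),\ \mathtt{body}^\lambda_r(\vec a)$ and $\mathtt{defeasibly\_q}(\vec a)\,\text{:-}\,not\ \mathtt{definitely\_{\sim}q}(\vec a),\ \mathtt{body}^d_r(\vec a),\ not\ \mathtt{overruled\_q}(\vec a)$; (iv) for each rule $s$ of any kind, $s: q_1(\vec a_1),\dots,q_n(\vec a_n)\hookrightarrow q(\vec a)$: $\mathtt{body}^\lambda_s(\vec a)\,\text{:-}\,\mathtt{lambda\_q_1}(\vec a_1),\dots,\mathtt{lambda\_q_n}(\vec a_n)$; $\mathtt{body}^d_s(\vec a)\,\text{:-}\,\mathtt{defeasibly\_q_1}(\vec a_1),\dots,\mathtt{defeasibly\_q_n}(\vec a_n)$; $\mathtt{overruled\_{\sim}q}(\vec a)\,\text{:-}\,\mathtt{body}^\lambda_s(\vec a),\ not\ \mathtt{defeated\_q}(s,\vec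 a)$; (v) for each strict or defeasible rule $t$ with consequent $q(\vec a)$ and each rule $s$ with consequent of the form ${\sim}q(\dots)$ such that $t>s$: $\mathtt{defeated\_{\sim}q}(s,\vec a)\,\text{:-}\,\mathtt{body}^d_t(\vec a)$. Rule labels are constants. $S^*_D$ is the same as $S_D$ except that the clauses for $\mathtt{defeasibly\_q}$ in (iii), the $\mathtt{overruled}$ clauses in (iv) and the clauses in (v) are replaced by: for each strict or defeasible rule $r$ with consequent $q(\vec a)$, $\mathtt{defeasibly\_q}(\vec a)\,\text{:-}\,not\ \mathtt{definitely\_{\sim}q}(\vec a),\ \mathtt{body}^d_r(\vec a),\ not\ \mathtt{overruled\_q}(r,\vec a)$; for each such $r$ and each rule $s$ with consequent ${\sim}q(\vec b)$, $\mathtt{overruled\_q}(r,\vec b)\,\text{:-}\,\mathtt{body}^\lambda_s(\vec b),\ not\ \mathtt{defeats\_q}(r,s)$; and for each $r>s$ with $r$ having consequent literal $q$, the unit clause $\mathtt{defeats\_q}(r,s)$. For a logic program $P$ and ground literal $\ell$ (an atom or $not\ A$), $P\models_{WF}\ell$ means that $\ell$ holds in the well-founded model of $P$ (computed on the ground instances of $P$). *)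

theory Defs
  imports Main
begin

section \<open>First-order syntax\<close>

datatype ('f, 'v) trm = Var 'v | Fn 'f "('f, 'v) trm list"

fun vars_trm :: "('f, 'v) trm \<Rightarrow> 'v set" where
  "vars_trm (Var x) = {x}"
| "vars_trm (Fn f ts) = (\<Union>t\<in>set ts. vars_trm t)"

fun subst_trm :: "('v \<Rightarrow> ('f, 'v) trm) \<Rightarrow> ('f, 'v) trm \<Rightarrow> ('f, 'v) trm" where
  "subst_trm \<sigma> (Var x) = \<sigma> x"
| "subst_trm \<sigma> (Fn f ts) = Fn f (map (subst_trm \<sigma>) ts)"

text \<open>A signature is a set of function symbols with arities; constants have arity 0. It determines
  the Herbrand universe, which may be finite, and is empty if there are no constants.\<close>

fun wf_trm :: "('f \<times> nat) set \<Rightarrow> ('f, 'v) trm \<Rightarrow> bool" where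
  "wf_trm \<Sigma> (Var x) \<longleftrightarrow> True"
| "wf_trm \<Sigma> (Fn f ts) \<longleftrightarrow> (f, length ts) \<in> \<Sigma> \<and> (\<forall>t\<in>set ts. wf_trm \<Sigma> t)"

definition herbrand_universe :: "('f \<times> nat) set \<Rightarrow> ('f, 'v) trm set" where
  "herbrand_universe \<Sigma> = {t. wf_trm \<Sigma> t \<and> vars_trm t = {}}"

datatype ('p, 'f, 'v) atom = Atom (pred: 'p) (atom_args: "('f, 'v) trm list")

definition vars_atom :: "('p, 'f, 'v) atom \<Rightarrow> 'v set" where
  "vars_atom A = (\<Union>t\<in>set (atom_args A). vars_trm t)"

definition subst_atom :: "('v \<Rightarrow> ('f, 'v) trm) \<Rightarrow> ('p, 'f, 'v) atom \<Rightarrow> ('p, 'f, 'v) atom" where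
  "subst_atom \<sigma> A = Atom (pred A) (map (subst_trm \<sigma>) (atom_args A))"

section \<open>Defeasible theories\<close>

datatype 'a literal = Pos (atom_of: 'a) | Neg (atom_of: 'a)

fun compl :: "'a literal \<Rightarrow> 'a literal" where
  "compl (Pos a) = Neg a"
| "compl (Neg a) = Pos a"

type_synonym ('p, 'f, 'v) lit = "('p, 'f, 'v) atom literal"

abbreviation args :: "('p, 'f, 'v) lit \<Rightarrow> ('f, 'v) trm list" where
  "args q \<equiv> atom_args (atom_of q)"

abbreviation vars_lit :: "('p, 'f, 'v) lit \<Rightarrow> 'v set" where
  "vars_lit q \<equiv> vars_atom (atom_of q)"

abbreviation subst_lit :: "('v \<Rightarrow> ('f, 'v) trm) \<Rightarrow> ('p, 'f, 'v) lit \<Rightarrow> ('p, 'f, 'v) lit" where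
  "subst_lit \<sigma> \<equiv> map_literal (subst_atom \<sigma>)"

definition wf_lit :: "('f \<times> nat) set \<Rightarrow> ('p, 'f, 'v) lit \<Rightarrow> bool" where
  "wf_lit \<Sigma> q \<longleftrightarrow> (\<forall>t\<in>set (args q). wf_trm \<Sigma> t)"

definition ground_lit :: "('f \<times> nat) set \<Rightarrow> ('p, 'f, 'v) lit \<Rightarrow> bool" where
  "ground_lit \<Sigma> q \<longleftrightarrow> wf_lit \<Sigma> q \<and> vars_lit q = {}"

datatype rule_kind = Strict | Defeasible | Defeater

text \<open>Rule labels are constants, hence elements of the type of function symbols. They may but
  need not belong to the signature of the theory.\<close>

record ('p, 'f, 'v) rule =
  label :: 'f
  antecedent :: "('p, 'f, 'v) lit set"
  consequent :: "('p, 'f, 'v) lit"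
  kind :: rule_kind

text \<open>\<open>(t, s) \<in> superior D\<close> is written \<open>t > s\<close> on paper.\<close>

record ('p, 'f, 'v) dtheory =
  facts :: "('p, 'f, 'v) lit set"
  rules :: "('p, 'f, 'v) rule set"
  superior :: "('f \<times> 'f) set"

definition defeasible_theory :: "('f \<times> nat) set \<Rightarrow> ('p, 'f, 'v) dtheory \<Rightarrow> bool" where
  "defeasible_theory \<Sigma> D \<longleftrightarrow>
     finite (facts D) \<and> (\<forall>q\<in>facts D. ground_lit \<Sigma> q) \<and>
     finite (rules D) \<and> inj_on label (rules D) \<and>
     (\<forall>r\<in>rules D. finite (antecedent r) \<and> wf_lit \<Sigma> (consequent r) \<and>
        (\<forall>q\<in>antecedent r. wf_lit \<Sigma> q)) \<and>
     superior D \<subseteq> label ` rules D \<times> label ` rules D \<and> acyclic (superior D)"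

definition strict_rules :: "('p, 'f, 'v) dtheory \<Rightarrow> ('p, 'f, 'v) rule set" where
  "strict_rules D = {r \<in> rules D. kind r = Strict}"

definition sd_rules :: "('p, 'f, 'v) dtheory \<Rightarrow> ('p, 'f, 'v) rule set" where
  "sd_rules D = {r \<in> rules D. kind r = Strict \<or> kind r = Defeasible}"

definition vars_rule :: "('p, 'f, 'v) rule \<Rightarrow> 'v set" where
  "vars_rule r = vars_lit (consequent r) \<union> (\<Union>q\<in>antecedent r. vars_lit q)"

definition subst_rule ::
    "('v \<Rightarrow> ('f, 'v) trm) \<Rightarrow> ('p, 'f, 'v) rule \<Rightarrow> ('p, 'f, 'v) rule" where
  "subst_rule \<sigma> r = r\<lparr>antecedent := subst_lit \<sigma> ` antecedent r,
                      consequent := subst_lit \<sigma> (consequent r)\<rparr>"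

text \<open>All instances of a rule keep its label, so that the superiority relation carries over. Only
  the variables that occur in the rule have to be mapped into the Herbrand universe: a
  variable-free rule has an instance even if the universe is empty.\<close>

definition ground_theory ::
    "('f \<times> nat) set \<Rightarrow> ('p, 'f, 'v) dtheory \<Rightarrow> ('p, 'f, 'v) dtheory" where
  "ground_theory \<Sigma> D = D\<lparr>rules :=
     {subst_rule \<sigma> r | \<sigma> r. r \<in> rules D \<and> (\<forall>x\<in>vars_rule r. \<sigma> x \<in> herbrand_universe \<Sigma>)}\<rparr>"

section \<open>Defeasible inference\<close>

text \<open>The following four sets are meant for ground theories.\<close>

inductive_set P_Delta :: "('p, 'f, 'v) dtheory \<Rightarrow> ('p, 'f, 'v) lit set"
  for D :: "('p, 'f, 'v) dtheory" where
  fact: "q \<in> facts D \<Longrightarrow> q \<in> P_Delta D"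
| strict: "\<lbrakk>r \<in> strict_rules D; consequent r = q; \<forall>\<alpha>\<in>antecedent r. \<alpha> \<in> P_Delta D\<rbrakk>
    \<Longrightarrow> q \<in> P_Delta D"

inductive_set P_lambda :: "('p, 'f, 'v) dtheory \<Rightarrow> ('p, 'f, 'v) lit set"
  for D :: "('p, 'f, 'v) dtheory" where
  Delta: "q \<in> P_Delta D \<Longrightarrow> q \<in> P_lambda D"
| rule: "\<lbrakk>r \<in> sd_rules D; consequent r = q; \<forall>\<alpha>\<in>antecedent r. \<alpha> \<in> P_lambda D;
    compl q \<notin> P_Delta D\<rbrakk> \<Longrightarrow> q \<in> P_lambda D"

inductive_set P_partial :: "('p, 'f, 'v) dtheory \<Rightarrow> ('p, 'f, 'v) lit set"
  for D :: "('p, 'f, 'v) dtheory" where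
  Delta: "q \<in> P_Delta D \<Longrightarrow> q \<in> P_partial D"
| rule: "\<lbrakk>r \<in> sd_rules D; consequent r = q; \<forall>\<alpha>\<in>antecedent r. \<alpha> \<in> P_partial D;
    compl q \<notin> P_Delta D;
    \<forall>s\<in>rules D. consequent s = compl q \<longrightarrow>
      (\<exists>\<alpha>\<in>antecedent s. \<alpha> \<notin> P_lambda D) \<or>
      (\<exists>t\<in>sd_rules D. consequent t = q \<and> (\<forall>\<alpha>\<in>antecedent t. \<alpha> \<in> P_partial D) \<and>
         (label t, label s) \<in> superior D)\<rbrakk>
    \<Longrightarrow> q \<in> P_partial D"

inductive_set P_partial_star :: "('p, 'f, 'v) dtheory \<Rightarrow> ('p, 'f, 'v) lit set"
  for D :: "('p, 'f, 'v) dtheory" where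
  Delta: "q \<in> P_Delta D \<Longrightarrow> q \<in> P_partial_star D"
| rule: "\<lbrakk>r \<in> sd_rules D; consequent r = q; \<forall>\<alpha>\<in>antecedent r. \<alpha> \<in> P_partial_star D;
    compl q \<notin> P_Delta D;
    \<forall>s\<in>rules D. consequent s = compl q \<longrightarrow>
      (\<exists>\<alpha>\<in>antecedent s. \<alpha> \<notin> P_lambda D) \<or> (label r, label s) \<in> superior D\<rbrakk>
    \<Longrightarrow> q \<in> P_partial_star D"

definition proves_Delta :: "('f \<times> nat) set \<Rightarrow> ('p, 'f, 'v) dtheory \<Rightarrow> ('p, 'f, 'v) lit \<Rightarrow> bool" where
  "proves_Delta \<Sigma> D q \<longleftrightarrow> q \<in> P_Delta (ground_theory \<Sigma> D)"

definition proves_lambda :: "('f \<times> nat) set \<Rightarrow> ('p, 'f, 'v) dtheory \<Rightarrow> ('p, 'f, 'v) lit \<Rightarrow> bool" where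
  "proves_lambda \<Sigma> D q \<longleftrightarrow> q \<in> P_lambda (ground_theory \<Sigma> D)"

definition proves_partial :: "('f \<times> nat) set \<Rightarrow> ('p, 'f, 'v) dtheory \<Rightarrow> ('p, 'f, 'v) lit \<Rightarrow> bool" where
  "proves_partial \<Sigma> D q \<longleftrightarrow> q \<in> P_partial (ground_theory \<Sigma> D)"

definition proves_partial_star ::
    "('f \<times> nat) set \<Rightarrow> ('p, 'f, 'v) dtheory \<Rightarrow> ('p, 'f, 'v) lit \<Rightarrow> bool" where
  "proves_partial_star \<Sigma> D q \<longleftrightarrow> q \<in> P_partial_star (ground_theory \<Sigma> D)"

section \<open>Logic programs and the well-founded model\<close>

datatype 'a plit = Is (plit_atom: 'a) | Naf (plit_atom: 'a)

fun plit_compl :: "'a plit \<Rightarrow> 'a plit" where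
  "plit_compl (Is a) = Naf a"
| "plit_compl (Naf a) = Is a"

datatype 'a clause = Clause (head: 'a) (body: "'a plit set")  (infix "\<Leftarrow>" 50)

definition vars_clause :: "('p, 'f, 'v) atom clause \<Rightarrow> 'v set" where
  "vars_clause c = vars_atom (head c) \<union> (\<Union>l\<in>body c. vars_atom (plit_atom l))"

definition subst_clause ::
    "('v \<Rightarrow> ('f, 'v) trm) \<Rightarrow> ('p, 'f, 'v) atom clause \<Rightarrow> ('p, 'f, 'v) atom clause" where
  "subst_clause \<sigma> c = (subst_atom \<sigma> (head c) \<Leftarrow> map_plit (subst_atom \<sigma>) ` body c)"

definition ground_program ::
    "('f \<times> nat) set \<Rightarrow> ('p, 'f, 'v) atom clause set \<Rightarrow> ('p, 'f, 'v) atom clause set" where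
  "ground_program \<Sigma> P =
     {subst_clause \<sigma> c | \<sigma> c. c \<in> P \<and> (\<forall>x\<in>vars_clause c. \<sigma> x \<in> herbrand_universe \<Sigma>)}"

text \<open>A three-valued interpretation is a set of program literals: \<open>Is a\<close> in the set means that
  \<open>a\<close> is true, \<open>Naf a\<close> in the set means that \<open>a\<close> is false. The well-founded model is the least
  fixpoint of the operator of Van Gelder, Ross and Schlipf.\<close>

definition immediate :: "'a clause set \<Rightarrow> 'a plit set \<Rightarrow> 'a set" where
  "immediate P I = {head c | c. c \<in> P \<and> body c \<subseteq> I}"

definition unfounded :: "'a clause set \<Rightarrow> 'a plit set \<Rightarrow> 'a set \<Rightarrow> bool" where
  "unfounded P I U \<longleftrightarrow> (\<forall>c\<in>P. head c \<in> U \<longrightarrow>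
     (\<exists>l\<in>body c. plit_compl l \<in> I) \<or> (\<exists>a\<in>U. Is a \<in> body c))"

definition greatest_unfounded :: "'a clause set \<Rightarrow> 'a plit set \<Rightarrow> 'a set" where
  "greatest_unfounded P I = \<Union>{U. unfounded P I U}"

definition wf_operator :: "'a clause set \<Rightarrow> 'a plit set \<Rightarrow> 'a plit set" where
  "wf_operator P I = Is ` immediate P I \<union> Naf ` greatest_unfounded P I"

lemma mono_wf_operator: "mono (wf_operator P)"
proof (rule monoI)
  fix I J :: "'a plit set"
  assume "I \<subseteq> J"
  then have "immediate P I \<subseteq> immediate P J" "\<And>U. unfounded P I U \<Longrightarrow> unfounded P J U"
    unfolding immediate_def unfounded_def by blast+
  then show "wf_operator P I \<subseteq> wf_operator P J"
    unfolding wf_operator_def greatest_unfounded_def by blast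
qed

definition wf_model :: "'a clause set \<Rightarrow> 'a plit set" where
  "wf_model P = lfp (wf_operator P)"

text \<open>The Herbrand universe is a parameter, so that a theory and its compiled program can be
  instantiated over the same terms: label constants that occur only in the program must not
  become values of the variables of the theory on one side alone. For instance, let \<open>\<not> p(c)\<close> be a
  fact and consider the rules \<open>r: \<Rightarrow> p(x)\<close> and \<open>t: p(x) \<Rightarrow> q\<close>: over the universe \<open>{c}\<close>, \<open>q\<close> has no
  proof, but it has one if the instance \<open>p(r)\<close> is admitted.\<close>

definition wf_entails ::
    "('f \<times> nat) set \<Rightarrow> ('p, 'f, 'v) atom clause set \<Rightarrow> ('p, 'f, 'v) atom plit \<Rightarrow> bool" where
  "wf_entails \<Sigma> P l \<longleftrightarrow> l \<in> wf_model (ground_program \<Sigma> P)"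

section \<open>The compiled programs\<close>

text \<open>Concatenated predicate names are rendered by constructors, so that different concatenations
  are different names. The name of a literal is \<open>Pos p\<close> for \<open>p\<close> and \<open>Neg p\<close> for \<open>not_p\<close>.\<close>

datatype ('p, 'f) pname =
    Definitely "'p literal" | Lambda "'p literal" | Defeasibly "'p literal"
  | Overruled "'p literal" | Defeated "'p literal" | Defeats "'p literal"
  | BodyDelta 'f | BodyLambda 'f | BodyD 'f

type_synonym ('p, 'f, 'v) patom = "(('p, 'f) pname, 'f, 'v) atom"

abbreviation name :: "('p, 'f, 'v) lit \<Rightarrow> 'p literal" where
  "name q \<equiv> map_literal pred q"

abbreviation const :: "'f \<Rightarrow> ('f, 'v) trm" where
  "const r \<equiv> Fn r []"

definition definitely :: "('p, 'f, 'v) lit \<Rightarrow> ('p, 'f, 'v) patom" where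
  "definitely q = Atom (Definitely (name q)) (args q)"

definition lambda :: "('p, 'f, 'v) lit \<Rightarrow> ('p, 'f, 'v) patom" where
  "lambda q = Atom (Lambda (name q)) (args q)"

definition defeasibly :: "('p, 'f, 'v) lit \<Rightarrow> ('p, 'f, 'v) patom" where
  "defeasibly q = Atom (Defeasibly (name q)) (args q)"

definition overruled :: "('p, 'f, 'v) lit \<Rightarrow> ('p, 'f, 'v) patom" where
  "overruled q = Atom (Overruled (name q)) (args q)"

definition defeated :: "'f \<Rightarrow> ('p, 'f, 'v) lit \<Rightarrow> ('p, 'f, 'v) patom" where
  "defeated s q = Atom (Defeated (name q)) (const s # args q)"

definition overruled_star :: "'f \<Rightarrow> ('p, 'f, 'v) lit \<Rightarrow> ('p, 'f, 'v) patom" where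
  "overruled_star r q = Atom (Overruled (name q)) (const r # args q)"

definition defeats :: "('p, 'f, 'v) lit \<Rightarrow> 'f \<Rightarrow> 'f \<Rightarrow> ('p, 'f, 'v) patom" where
  "defeats q r s = Atom (Defeats (name q)) [const r, const s]"

definition body_Delta :: "('p, 'f, 'v) rule \<Rightarrow> ('p, 'f, 'v) patom" where
  "body_Delta r = Atom (BodyDelta (label r)) (args (consequent r))"

definition body_lambda :: "('p, 'f, 'v) rule \<Rightarrow> ('p, 'f, 'v) patom" where
  "body_lambda r = Atom (BodyLambda (label r)) (args (consequent r))"

definition body_d :: "('p, 'f, 'v) rule \<Rightarrow> ('p, 'f, 'v) patom" where
  "body_d r = Atom (BodyD (label r)) (args (consequent r))"

text \<open>The clauses shared by both programs.\<close>

definition S_common :: "('p, 'f, 'v) dtheory \<Rightarrow> ('p, 'f, 'v) patom clause set" where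
  "S_common D =
     {definitely q \<Leftarrow> {} | q. q \<in> facts D} \<union>
     {lambda q \<Leftarrow> {} | q. q \<in> facts D} \<union>
     {defeasibly q \<Leftarrow> {} | q. q \<in> facts D} \<union>
     {definitely (consequent r) \<Leftarrow> {Is (body_Delta r)} | r. r \<in> strict_rules D} \<union>
     {lambda (consequent r) \<Leftarrow> {Is (body_Delta r)} | r. r \<in> strict_rules D} \<union>
     {defeasibly (consequent r) \<Leftarrow> {Is (body_Delta r)} | r. r \<in> strict_rules D} \<union>
     {body_Delta r \<Leftarrow> (\<lambda>\<alpha>. Is (definitely \<alpha>)) ` antecedent r | r. r \<in> strict_rules D} \<union>
     {lambda (consequent r) \<Leftarrow> {Naf (definitely (compl (consequent r))), Is (body_lambda r)}
        | r. r \<in> sd_rules D} \<union>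
     {body_lambda s \<Leftarrow> (\<lambda>\<alpha>. Is (lambda \<alpha>)) ` antecedent s | s. s \<in> rules D} \<union>
     {body_d s \<Leftarrow> (\<lambda>\<alpha>. Is (defeasibly \<alpha>)) ` antecedent s | s. s \<in> rules D}"

text \<open>In the last group of clauses, the consequents of \<open>t\<close> and \<open>s\<close> have complementary names, but
  their arguments are unrelated; the arguments in the clause are those of \<open>t\<close>.\<close>

definition S_program :: "('p, 'f, 'v) dtheory \<Rightarrow> ('p, 'f, 'v) patom clause set" where
  "S_program D = S_common D \<union>
     {defeasibly (consequent r) \<Leftarrow>
        {Naf (definitely (compl (consequent r))), Is (body_d r), Naf (overruled (consequent r))}
        | r. r \<in> sd_rules D} \<union>
     {overruled (compl (consequent s)) \<Leftarrow>
        {Is (body_lambda s), Naf (defeated (label s) (consequent s))}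
        | s. s \<in> rules D} \<union>
     {defeated (label s) (compl (consequent t)) \<Leftarrow> {Is (body_d t)}
        | t s. t \<in> sd_rules D \<and> s \<in> rules D \<and>
               name (consequent s) = compl (name (consequent t)) \<and>
               (label t, label s) \<in> superior D}"

text \<open>Here, too, the consequents of \<open>r\<close> and \<open>s\<close> are only required to have complementary names; the
  arguments in the clause for \<open>overruled_star\<close> are those of \<open>s\<close>.\<close>

definition S_star_program :: "('p, 'f, 'v) dtheory \<Rightarrow> ('p, 'f, 'v) patom clause set" where
  "S_star_program D = S_common D \<union>
     {defeasibly (consequent r) \<Leftarrow>
        {Naf (definitely (compl (consequent r))), Is (body_d r),
         Naf (overruled_star (label r) (consequent r))}
        | r. r \<in> sd_rules D} \<union>
     {overruled_star (label r) (compl (consequent s)) \<Leftarrow>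
        {Is (body_lambda s), Naf (defeats (consequent r) (label r) (label s))}
        | r s. r \<in> sd_rules D \<and> s \<in> rules D \<and>
               name (consequent s) = compl (name (consequent r))} \<union>
     {defeats (consequent r) (label r) (label s) \<Leftarrow> {}
        | r s. r \<in> rules D \<and> s \<in> rules D \<and> (label r, label s) \<in> superior D}"

end

theory Submission
  imports Defs
begin

text \<open>Provable literals are true in the well-founded model by rule induction; for each
  inference, the singleton consisting of the \<open>overruled\<close> atom of its conclusion is an
  unfounded set. For the converse, the model is the least prefixpoint of its operator, so it is
  enough to give one prefixpoint that makes \<open>defeasibly q\<close> true only for provable \<open>q\<close>. On the atoms
  that serve the strict and the lambda inferences it is the intended total interpretation. The rest
  of the program need not be stratified, and its model may leave atoms undefined, but a prefixpoint
  may be inconsistent, which removes the need to know which atoms these are.\<close>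

section \<open>Well-founded models\<close>

text \<open>Dependence runs in a circle from \<open>defeasibly\<close> through
  \<open>overruled\<close>, \<open>defeated\<close> and \<open>body_d\<close> back to
  \<open>defeasibly\<close>, with two negations on the way. For the propositional rules r: => q, t:
  q => q and s: => ~q with t > s, the atom \<open>defeasibly q\<close> is undefined although q
  merely has no proof, so falsity in the model cannot mirror unprovability. Because the negations
  are even in number, however, the truth of \<open>defeasibly\<close> uses, besides base literals,
  only the falsity of \<open>overruled\<close>, which uses only the truth of
  \<open>defeated\<close>, which uses only the truth of \<open>defeasibly\<close> again. The
  opposite values never flow into these and may be overestimated freely. In the starred program no
  cycle passes through a negation, but the same argument serves. A second obstacle is that a body
  atom keeps only the label and the arguments of the consequent. Instances that differ in variables
  local to the antecedent share it, so its truth can be traced back only to some instance with the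
  same label, consequent and kind. This is all that the inferences need.\<close>

lemma wf_model_unfold: "wf_model P = wf_operator P (wf_model P)"
  unfolding wf_model_def by (rule lfp_unfold[OF mono_wf_operator])

lemma wf_model_Is: "c \<in> P \<Longrightarrow> body c \<subseteq> wf_model P \<Longrightarrow> Is (head c) \<in> wf_model P"
  by (subst wf_model_unfold) (auto simp: wf_operator_def immediate_def)

lemma wf_model_Naf: "unfounded P (wf_model P) U \<Longrightarrow> a \<in> U \<Longrightarrow> Naf a \<in> wf_model P"
  by (subst wf_model_unfold) (auto simp: wf_operator_def greatest_unfounded_def)

text \<open>The second premise tests each unfounded set separately: the greatest one is their union,
  so it never has to be computed.\<close>

lemma wf_model_subset:
  assumes "\<And>c. c \<in> P \<Longrightarrow> body c \<subseteq> I \<Longrightarrow> Is (head c) \<in> I"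
    and "\<And>U a. unfounded P I U \<Longrightarrow> a \<in> U \<Longrightarrow> Naf a \<in> I"
  shows "wf_model P \<subseteq> I"
  unfolding wf_model_def
  by (rule lfp_lowerbound)
    (use assms in \<open>auto simp: wf_operator_def immediate_def greatest_unfounded_def\<close>)

section \<open>Substitution\<close>

lemma subst_trm_ground: "vars_trm t = {} \<Longrightarrow> subst_trm \<sigma> t = t"
  by (induction t) (auto intro: map_idI)

lemma subst_atom_ground: "vars_atom a = {} \<Longrightarrow> subst_atom \<sigma> a = a"
  by (cases a) (auto simp: vars_atom_def subst_atom_def subst_trm_ground intro!: map_idI)

lemma subst_lit_ground: "vars_lit q = {} \<Longrightarrow> subst_lit \<sigma> q = q"
  by (cases q) (auto simp: subst_atom_ground)

lemma name_subst_lit [simp]: "name (subst_lit \<sigma> q) = name q"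
  by (cases q) (auto simp: subst_atom_def)

lemma args_subst_lit [simp]: "args (subst_lit \<sigma> q) = map (subst_trm \<sigma>) (args q)"
  by (cases q) (auto simp: subst_atom_def)

lemma compl_subst_lit [simp]: "compl (subst_lit \<sigma> q) = subst_lit \<sigma> (compl q)"
  by (cases q) auto

lemma compl_compl [simp]: "compl (compl q) = q"
  by (cases q) auto

lemma name_compl [simp]: "name (compl q) = compl (name q)"
  by (cases q) auto

lemma atom_of_compl [simp]: "atom_of (compl q) = atom_of q"
  by (cases q) auto

lemma lit_eqI: "name p = name q \<Longrightarrow> args p = args q \<Longrightarrow> p = q"
  by (cases p; cases q) (auto intro: atom.expand)

lemma subst_rule_simps [simp]:
  "label (subst_rule \<sigma> r) = label r"
  "kind (subst_rule \<sigma> r) = kind r"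
  "consequent (subst_rule \<sigma> r) = subst_lit \<sigma> (consequent r)"
  "antecedent (subst_rule \<sigma> r) = subst_lit \<sigma> ` antecedent r"
  by (auto simp: subst_rule_def)

lemmas patom_defs = definitely_def lambda_def defeasibly_def overruled_def defeated_def
  overruled_star_def defeats_def body_Delta_def body_lambda_def body_d_def

text \<open>The body atoms and \<open>defeats\<close> are missing on purpose. A body atom forgets
  the antecedent and \<open>defeats\<close> forgets the arguments of its literal, so neither is
  injective.\<close>

lemma patom_inject [simp]:
  "definitely p = definitely q \<longleftrightarrow> p = q"
  "lambda p = lambda q \<longleftrightarrow> p = q"
  "defeasibly p = defeasibly q \<longleftrightarrow> p = q"
  "overruled p = overruled q \<longleftrightarrow> p = q"
  "defeated l p = defeated m q \<longleftrightarrow> l = m \<and> p = q"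
  "overruled_star l p = overruled_star m q \<longleftrightarrow> l = m \<and> p = q"
  by (auto simp: patom_defs intro: lit_eqI)

text \<open>Comparing predicates separates atoms of different forms without a quadratic list of
  inequalities; later proofs apply \<open>pred\<close> to both sides of an equation for this
  purpose.\<close>

lemma pred_patom [simp]:
  "pred (definitely q) = Definitely (name q)"
  "pred (lambda q) = Lambda (name q)"
  "pred (defeasibly q) = Defeasibly (name q)"
  "pred (overruled q) = Overruled (name q)"
  "pred (defeated l q) = Defeated (name q)"
  "pred (overruled_star l q) = Overruled (name q)"
  "pred (defeats q l m) = Defeats (name q)"
  "pred (body_Delta r) = BodyDelta (label r)"
  "pred (body_lambda r) = BodyLambda (label r)"
  "pred (body_d r) = BodyD (label r)"
  by (auto simp: patom_defs)

lemma subst_patom [simp]: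
  "subst_atom \<sigma> (definitely q) = definitely (subst_lit \<sigma> q)"
  "subst_atom \<sigma> (lambda q) = lambda (subst_lit \<sigma> q)"
  "subst_atom \<sigma> (defeasibly q) = defeasibly (subst_lit \<sigma> q)"
  "subst_atom \<sigma> (overruled q) = overruled (subst_lit \<sigma> q)"
  "subst_atom \<sigma> (defeated l q) = defeated l (subst_lit \<sigma> q)"
  "subst_atom \<sigma> (overruled_star l q) = overruled_star l (subst_lit \<sigma> q)"
  "subst_atom \<sigma> (defeats q l m) = defeats q l m"
  "subst_atom \<sigma> (body_Delta r) = body_Delta (subst_rule \<sigma> r)"
  "subst_atom \<sigma> (body_lambda r) = body_lambda (subst_rule \<sigma> r)"
  "subst_atom \<sigma> (body_d r) = body_d (subst_rule \<sigma> r)"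
  by (auto simp: patom_defs subst_atom_def)

lemma vars_patom [simp]:
  "vars_atom (definitely q) = vars_lit q"
  "vars_atom (lambda q) = vars_lit q"
  "vars_atom (defeasibly q) = vars_lit q"
  "vars_atom (overruled q) = vars_lit q"
  "vars_atom (defeated l q) = vars_lit q"
  "vars_atom (overruled_star l q) = vars_lit q"
  "vars_atom (defeats q l m) = {}"
  "vars_atom (body_Delta r) = vars_lit (consequent r)"
  "vars_atom (body_lambda r) = vars_lit (consequent r)"
  "vars_atom (body_d r) = vars_lit (consequent r)"
  by (auto simp: patom_defs vars_atom_def)

section \<open>Instances\<close>

definition instances_over ::
    "(('p, 'f, 'v) rule \<Rightarrow> 'v set) \<Rightarrow> ('f \<times> nat) set \<Rightarrow> ('p, 'f, 'v) rule set \<Rightarrow>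
      ('p, 'f, 'v) rule set" where
  "instances_over V \<Sigma> R =
     {subst_rule \<sigma> r | \<sigma> r. r \<in> R \<and> (\<forall>x\<in>V r. \<sigma> x \<in> herbrand_universe \<Sigma>)}"

abbreviation instances :: "('f \<times> nat) set \<Rightarrow> ('p, 'f, 'v) rule set \<Rightarrow> ('p, 'f, 'v) rule set" where
  "instances \<equiv> instances_over vars_rule"

text \<open>A clause that mentions a rule only through its consequent and its body atom does not contain
  the variables that occur in the antecedent alone. If the Herbrand universe is empty, it may have
  instances that do not stem from an instance of the rule.\<close>

abbreviation weak_instances ::
    "('f \<times> nat) set \<Rightarrow> ('p, 'f, 'v) rule set \<Rightarrow> ('p, 'f, 'v) rule set" where
  "weak_instances \<equiv> instances_over (\<lambda>r. vars_lit (consequent r))"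

lemma instances_weak: "r \<in> instances \<Sigma> R \<Longrightarrow> r \<in> weak_instances \<Sigma> R"
  by (auto simp: instances_over_def vars_rule_def)

lemma ground_theory_simps [simp]:
  "facts (ground_theory \<Sigma> D) = facts D"
  "superior (ground_theory \<Sigma> D) = superior D"
  "rules (ground_theory \<Sigma> D) = instances \<Sigma> (rules D)"
  "strict_rules (ground_theory \<Sigma> D) = instances \<Sigma> (strict_rules D)"
  "sd_rules (ground_theory \<Sigma> D) = instances \<Sigma> (sd_rules D)"
  by (auto simp: ground_theory_def instances_over_def strict_rules_def sd_rules_def)
    (metis subst_rule_simps(2))+

lemma sd_rules_subset: "sd_rules D \<subseteq> rules D"
  by (auto simp: sd_rules_def)

lemma strict_rules_subset: "strict_rules D \<subseteq> rules D"
  by (auto simp: strict_rules_def)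

lemma ground_program_Un:
  "ground_program \<Sigma> (P \<union> Q) = ground_program \<Sigma> P \<union> ground_program \<Sigma> Q"
  by (auto simp: ground_program_def)

lemma ground_program_ground:
  assumes "\<And>c. c \<in> P \<Longrightarrow> vars_clause c = {}"
    and "\<And>c \<sigma>. c \<in> P \<Longrightarrow> subst_clause \<sigma> c = c"
  shows "ground_program \<Sigma> P = P"
proof
  show "ground_program \<Sigma> P \<subseteq> P"
    by (auto simp: ground_program_def assms(2))
  show "P \<subseteq> ground_program \<Sigma> P"
  proof
    fix c assume "c \<in> P"
    \<comment> \<open>\<open>Var\<close> serves as the grounding substitution: the clause has no
      variables, so the condition is vacuous even over an empty universe.\<close>
    then have "c = subst_clause Var c" "\<forall>x\<in>vars_clause c. Var x \<in> herbrand_universe \<Sigma>"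
      using assms by auto
    with \<open>c \<in> P\<close> show "c \<in> ground_program \<Sigma> P"
      unfolding ground_program_def by blast
  qed
qed

text \<open>Some clauses depend on two rules but contain the variables of only one. The index
  \<open>i\<close> is the other rule, of which only the label and the name of the consequent enter;
  the side condition \<open>Q\<close> reads only such data, so it survives substitution.\<close>

lemma ground_program_instances_indexed:
  assumes "\<And>i \<sigma> r. subst_clause \<sigma> (F i r) = F i (subst_rule \<sigma> r)"
    and "\<And>i r. vars_clause (F i r) = V r"
    and "\<And>i \<sigma> r. Q i (subst_rule \<sigma> r) = Q i r"
  shows "ground_program \<Sigma> {F i r | i r. i \<in> I \<and> r \<in> R \<and> Q i r} =
    {F i r | i r. i \<in> I \<and> r \<in> instances_over V \<Sigma> R \<and> Q i r}" (is "?L = ?R")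
proof
  show "?L \<subseteq> ?R"
  proof
    fix c assume "c \<in> ?L"
    then obtain \<sigma> i r where "c = F i (subst_rule \<sigma> r)" "i \<in> I" "r \<in> R" "Q i (subst_rule \<sigma> r)"
      "\<forall>x\<in>V r. \<sigma> x \<in> herbrand_universe \<Sigma>"
      unfolding ground_program_def by (auto simp: assms)
    then show "c \<in> ?R"
      unfolding instances_over_def by blast
  qed
  show "?R \<subseteq> ?L"
  proof
    fix c assume "c \<in> ?R"
    then obtain \<sigma> i r where "c = subst_clause \<sigma> (F i r)" "i \<in> I" "r \<in> R" "Q i r"
      "\<forall>x\<in>vars_clause (F i r). \<sigma> x \<in> herbrand_universe \<Sigma>"
      unfolding instances_over_def by (auto simp: assms)
    then show "c \<in> ?L"
      unfolding ground_program_def by blast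
  qed
qed

lemma ground_program_instances:
  assumes "\<And>\<sigma> r. subst_clause \<sigma> (F r) = F (subst_rule \<sigma> r)"
    and "\<And>r. vars_clause (F r) = V r"
  shows "ground_program \<Sigma> {F r | r. r \<in> R} = {F r | r. r \<in> instances_over V \<Sigma> R}"
  using ground_program_instances_indexed[of "\<lambda>_. F" V "\<lambda>_ _. True" \<Sigma> UNIV R] assms by simp

section \<open>The grounded programs\<close>

definition ground_common ::
    "('f \<times> nat) set \<Rightarrow> ('p, 'f, 'v) dtheory \<Rightarrow> ('p, 'f, 'v) patom clause set" where
  "ground_common \<Sigma> D =
     {definitely q \<Leftarrow> {} | q. q \<in> facts D} \<union>
     {lambda q \<Leftarrow> {} | q. q \<in> facts D} \<union>
     {defeasibly q \<Leftarrow> {} | q. q \<in> facts D} \<union>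
     {definitely (consequent r) \<Leftarrow> {Is (body_Delta r)} | r. r \<in> weak_instances \<Sigma> (strict_rules D)} \<union>
     {lambda (consequent r) \<Leftarrow> {Is (body_Delta r)} | r. r \<in> weak_instances \<Sigma> (strict_rules D)} \<union>
     {defeasibly (consequent r) \<Leftarrow> {Is (body_Delta r)} | r. r \<in> weak_instances \<Sigma> (strict_rules D)} \<union>
     {body_Delta r \<Leftarrow> (\<lambda>\<alpha>. Is (definitely \<alpha>)) ` antecedent r
        | r. r \<in> instances \<Sigma> (strict_rules D)} \<union>
     {lambda (consequent r) \<Leftarrow> {Naf (definitely (compl (consequent r))), Is (body_lambda r)}
        | r. r \<in> weak_instances \<Sigma> (sd_rules D)} \<union>
     {body_lambda s \<Leftarrow> (\<lambda>\<alpha>. Is (lambda \<alpha>)) ` antecedent s | s. s \<in> instances \<Sigma> (rules D)} \<union>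
     {body_d s \<Leftarrow> (\<lambda>\<alpha>. Is (defeasibly \<alpha>)) ` antecedent s | s. s \<in> instances \<Sigma> (rules D)}"

lemma ground_S_common:
  assumes "defeasible_theory \<Sigma> D"
  shows "ground_program \<Sigma> (S_common D) = ground_common \<Sigma> D"
proof -
  have facts: "vars_lit q = {}" "subst_lit \<sigma> q = q" if "q \<in> facts D" for q \<sigma>
    using assms that by (auto simp: defeasible_theory_def ground_lit_def intro!: subst_lit_ground)
  have 1: "ground_program \<Sigma> {definitely q \<Leftarrow> {} | q. q \<in> facts D} = {definitely q \<Leftarrow> {} | q. q \<in> facts D}"
    "ground_program \<Sigma> {lambda q \<Leftarrow> {} | q. q \<in> facts D} = {lambda q \<Leftarrow> {} | q. q \<in> facts D}"
    "ground_program \<Sigma> {defeasibly q \<Leftarrow> {} | q. q \<in> facts D} = {defeasibly q \<Leftarrow> {} | q. q \<in> facts D}"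
    by (rule ground_program_ground; auto simp: vars_clause_def subst_clause_def facts)+
  show ?thesis
    unfolding S_common_def ground_common_def ground_program_Un 1
    by (intro arg_cong2[where f = "(\<union>)"] refl ground_program_instances;
        auto simp: vars_clause_def subst_clause_def vars_rule_def image_image)
qed

definition ground_S ::
    "('f \<times> nat) set \<Rightarrow> ('p, 'f, 'v) dtheory \<Rightarrow> ('p, 'f, 'v) patom clause set" where
  "ground_S \<Sigma> D = ground_common \<Sigma> D \<union>
     {defeasibly (consequent r) \<Leftarrow>
        {Naf (definitely (compl (consequent r))), Is (body_d r), Naf (overruled (consequent r))}
        | r. r \<in> weak_instances \<Sigma> (sd_rules D)} \<union>
     {overruled (compl (consequent s)) \<Leftarrow>
        {Is (body_lambda s), Naf (defeated (label s) (consequent s))}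
        | s. s \<in> weak_instances \<Sigma> (rules D)} \<union>
     {defeated (label s) (compl (consequent t)) \<Leftarrow> {Is (body_d t)}
        | t s. t \<in> weak_instances \<Sigma> (sd_rules D) \<and> s \<in> rules D \<and>
               name (consequent s) = compl (name (consequent t)) \<and>
               (label t, label s) \<in> superior D}"

lemma ground_S_program:
  assumes "defeasible_theory \<Sigma> D"
  shows "ground_program \<Sigma> (S_program D) = ground_S \<Sigma> D"
proof -
  \<comment> \<open>The rule \<open>s\<close> contributes only a label and a name, so it is the
    index. The binders are permuted and the side conditions bracketed to match the general
    lemma.\<close>
  have reorder: "{defeated (label s) (compl (consequent t)) \<Leftarrow> {Is (body_d t)}
        | t s. t \<in> T \<and> s \<in> rules D \<and>
               name (consequent s) = compl (name (consequent t)) \<and>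
               (label t, label s) \<in> superior D} =
     {defeated (label s) (compl (consequent t)) \<Leftarrow> {Is (body_d t)}
        | s t. s \<in> rules D \<and> t \<in> T \<and>
               (name (consequent s) = compl (name (consequent t)) \<and>
                (label t, label s) \<in> superior D)}" for T
    by blast
  have defeated: "ground_program \<Sigma> {defeated (label s) (compl (consequent t)) \<Leftarrow> {Is (body_d t)}
        | t s. t \<in> sd_rules D \<and> s \<in> rules D \<and>
               name (consequent s) = compl (name (consequent t)) \<and>
               (label t, label s) \<in> superior D} =
     {defeated (label s) (compl (consequent t)) \<Leftarrow> {Is (body_d t)}
        | t s. t \<in> weak_instances \<Sigma> (sd_rules D) \<and> s \<in> rules D \<and>
               name (consequent s) = compl (name (consequent t)) \<and>
               (label t, label s) \<in> superior D}"
    unfolding reorder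
    by (rule ground_program_instances_indexed) (auto simp: vars_clause_def subst_clause_def)
  show ?thesis
    unfolding S_program_def ground_S_def ground_program_Un ground_S_common[OF assms] defeated
    by (intro arg_cong2[where f = "(\<union>)"] refl ground_program_instances;
        auto simp: vars_clause_def subst_clause_def)
qed

definition ground_S_star ::
    "('f \<times> nat) set \<Rightarrow> ('p, 'f, 'v) dtheory \<Rightarrow> ('p, 'f, 'v) patom clause set" where
  "ground_S_star \<Sigma> D = ground_common \<Sigma> D \<union>
     {defeasibly (consequent r) \<Leftarrow>
        {Naf (definitely (compl (consequent r))), Is (body_d r),
         Naf (overruled_star (label r) (consequent r))}
        | r. r \<in> weak_instances \<Sigma> (sd_rules D)} \<union>
     {overruled_star (label r) (compl (consequent s)) \<Leftarrow>
        {Is (body_lambda s), Naf (defeats (consequent r) (label r) (label s))}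
        | r s. r \<in> sd_rules D \<and> s \<in> weak_instances \<Sigma> (rules D) \<and>
               name (consequent s) = compl (name (consequent r))} \<union>
     {defeats (consequent r) (label r) (label s) \<Leftarrow> {}
        | r s. r \<in> rules D \<and> s \<in> rules D \<and> (label r, label s) \<in> superior D}"

lemma ground_S_star_program:
  assumes "defeasible_theory \<Sigma> D"
  shows "ground_program \<Sigma> (S_star_program D) = ground_S_star \<Sigma> D"
proof -
  have overruled: "ground_program \<Sigma> {overruled_star (label r) (compl (consequent s)) \<Leftarrow>
        {Is (body_lambda s), Naf (defeats (consequent r) (label r) (label s))}
        | r s. r \<in> sd_rules D \<and> s \<in> rules D \<and>
               name (consequent s) = compl (name (consequent r))} =
     {overruled_star (label r) (compl (consequent s)) \<Leftarrow>
        {Is (body_lambda s), Naf (defeats (consequent r) (label r) (label s))}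
        | r s. r \<in> sd_rules D \<and> s \<in> weak_instances \<Sigma> (rules D) \<and>
               name (consequent s) = compl (name (consequent r))}"
    by (rule ground_program_instances_indexed) (auto simp: vars_clause_def subst_clause_def)
  have defeats: "ground_program \<Sigma> {defeats (consequent r) (label r) (label s) \<Leftarrow> {}
        | r s. r \<in> rules D \<and> s \<in> rules D \<and> (label r, label s) \<in> superior D} =
      {defeats (consequent r) (label r) (label s) \<Leftarrow> {}
        | r s. r \<in> rules D \<and> s \<in> rules D \<and> (label r, label s) \<in> superior D}"
    by (rule ground_program_ground) (auto simp: vars_clause_def subst_clause_def)
  show ?thesis
    unfolding S_star_program_def ground_S_star_def ground_program_Un ground_S_common[OF assms] overruled defeats
    by (intro arg_cong2[where f = "(\<union>)"] refl ground_program_instances;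
        auto simp: vars_clause_def subst_clause_def)
qed

section \<open>The strict and the lambda layer\<close>

text \<open>The clauses for \<open>definitely\<close>, \<open>lambda\<close> and their body atoms form a stratified subprogram, on
  which the well-founded model is total.\<close>

fun in_base :: "('p, 'f) pname \<Rightarrow> bool" where
  "in_base (Definitely _) = True"
| "in_base (Lambda _) = True"
| "in_base (BodyDelta _) = True"
| "in_base (BodyLambda _) = True"
| "in_base _ = False"

text \<open>Both \<open>overruled\<close> and \<open>overruled_star\<close> are built with
  \<open>Overruled\<close>, which lets one interpretation scheme serve both programs.\<close>

fun is_overruled :: "('p, 'f) pname \<Rightarrow> bool" where
  "is_overruled (Overruled _) = True"
| "is_overruled _ = False"

fun in_conflict :: "('p, 'f) pname \<Rightarrow> bool" where
  "in_conflict (Overruled _) = True"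
| "in_conflict (Defeated _) = True"
| "in_conflict (Defeats _) = True"
| "in_conflict _ = False"

locale compilation =
  fixes \<Sigma> :: "('f \<times> nat) set" and D :: "('p, 'f, 'v) dtheory"
  assumes dtheory: "defeasible_theory \<Sigma> D"
begin

abbreviation "G \<equiv> ground_theory \<Sigma> D"

text \<open>A label determines the rule of \<open>D\<close>, and substitution changes neither the
  kind nor the name of the consequent, so the arguments fix the rest. The antecedents may still
  differ.\<close>

lemma weak_instance_unique:
  assumes "r \<in> weak_instances \<Sigma> (rules D)" "s \<in> weak_instances \<Sigma> (rules D)"
    and "label r = label s" "args (consequent r) = args (consequent s)"
  shows "consequent r = consequent s \<and> kind r = kind s"
proof -
  obtain \<sigma> \<tau> r' s' where rs: "r = subst_rule \<sigma> r'" "r' \<in> rules D" "s = subst_rule \<tau> s'" "s' \<in> rules D"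
    using assms(1,2) by (auto simp: instances_over_def)
  moreover have "r' = s'"
    using dtheory assms(3) rs by (auto simp: defeasible_theory_def dest: inj_onD)
  ultimately show ?thesis
    using assms(4) by (auto intro!: lit_eqI)
qed

text \<open>This links a clause of the program, which stems from a weak instance \<open>w\<close>,
  to a genuine rule instance \<open>g\<close> that makes its body atom true. The antecedent of
  \<open>w\<close> itself need not be satisfied.\<close>

lemma body_unique:
  assumes "w \<in> weak_instances \<Sigma> (rules D)" "g \<in> rules G"
    and "body_Delta w = body_Delta g \<or> body_lambda w = body_lambda g \<or> body_d w = body_d g"
  shows "label w = label g \<and> consequent w = consequent g \<and> kind w = kind g"
proof -
  have "label w = label g" "args (consequent w) = args (consequent g)"
    using assms(3) by (auto simp: patom_defs)
  then show ?thesis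
    using weak_instance_unique[OF assms(1) instances_weak] assms(2) by simp
qed

lemma weak_sd: "w \<in> weak_instances \<Sigma> (sd_rules D) \<Longrightarrow>
    w \<in> weak_instances \<Sigma> (rules D) \<and> (kind w = Strict \<or> kind w = Defeasible)"
  by (auto simp: instances_over_def sd_rules_def)

lemma weak_strict: "w \<in> weak_instances \<Sigma> (strict_rules D) \<Longrightarrow> w \<in> weak_instances \<Sigma> (rules D)"
  by (auto simp: instances_over_def strict_rules_def)

lemma sd_rulesI: "r \<in> rules G \<Longrightarrow> kind r = Strict \<or> kind r = Defeasible \<Longrightarrow> r \<in> sd_rules G"
  unfolding sd_rules_def by blast

definition base_true :: "('p, 'f, 'v) patom set" where
  "base_true = definitely ` P_Delta G \<union> lambda ` P_lambda G \<union>
     {body_Delta r | r. r \<in> strict_rules G \<and> antecedent r \<subseteq> P_Delta G} \<union>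
     {body_lambda r | r. r \<in> rules G \<and> antecedent r \<subseteq> P_lambda G}"

lemma definitely_base_true [simp]: "definitely q \<in> base_true \<longleftrightarrow> q \<in> P_Delta G"
  by (auto simp: base_true_def dest: arg_cong[where f = pred])

lemma lambda_base_true [simp]: "lambda q \<in> base_true \<longleftrightarrow> q \<in> P_lambda G"
  by (auto simp: base_true_def dest: arg_cong[where f = pred])

lemma body_Delta_base_trueI:
  "r \<in> strict_rules G \<Longrightarrow> antecedent r \<subseteq> P_Delta G \<Longrightarrow> body_Delta r \<in> base_true"
  unfolding base_true_def by blast

lemma body_lambda_base_trueI:
  "r \<in> rules G \<Longrightarrow> antecedent r \<subseteq> P_lambda G \<Longrightarrow> body_lambda r \<in> base_true"
  unfolding base_true_def by blast

lemma body_Delta_base_trueD: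
  assumes "body_Delta w \<in> base_true" "w \<in> weak_instances \<Sigma> (strict_rules D)"
  shows "consequent w \<in> P_Delta G"
proof -
  obtain g where g: "body_Delta w = body_Delta g" "g \<in> strict_rules G" "antecedent g \<subseteq> P_Delta G"
    using assms(1) by (auto simp: base_true_def dest: arg_cong[where f = pred])
  moreover have "g \<in> rules G"
    using g(2) strict_rules_subset by blast
  ultimately have "consequent w = consequent g"
    using body_unique weak_strict assms(2) by blast
  then show ?thesis
    using g P_Delta.strict[of g G] by auto
qed

lemma body_lambda_base_trueE:
  assumes "body_lambda w \<in> base_true" "w \<in> weak_instances \<Sigma> (rules D)"
  obtains g where "g \<in> rules G" "antecedent g \<subseteq> P_lambda G"
    "label w = label g" "consequent w = consequent g" "kind w = kind g"
proof -
  obtain g where "body_lambda w = body_lambda g" "g \<in> rules G" "antecedent g \<subseteq> P_lambda G"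
    using assms(1) by (auto simp: base_true_def dest: arg_cong[where f = pred])
  then show ?thesis
    using that body_unique assms(2) by blast
qed

lemma body_lambda_base_trueD:
  assumes "body_lambda w \<in> base_true" "w \<in> weak_instances \<Sigma> (sd_rules D)"
    "compl (consequent w) \<notin> P_Delta G"
  shows "consequent w \<in> P_lambda G"
proof -
  have w: "w \<in> weak_instances \<Sigma> (rules D)" "kind w = Strict \<or> kind w = Defeasible"
    using weak_sd assms(2) by auto
  obtain g where g: "g \<in> rules G" "antecedent g \<subseteq> P_lambda G"
    "consequent w = consequent g" "kind w = kind g"
    using body_lambda_base_trueE[OF assms(1) w(1)] by metis
  have "g \<in> sd_rules G"
    using sd_rulesI[OF g(1)] g(4) w(2) by simp
  then show ?thesis
    using g(2,3) assms(3) by (auto intro: P_lambda.rule)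
qed

lemma common_intros:
  "q \<in> facts D \<Longrightarrow> (definitely q \<Leftarrow> {}) \<in> ground_common \<Sigma> D"
  "q \<in> facts D \<Longrightarrow> (lambda q \<Leftarrow> {}) \<in> ground_common \<Sigma> D"
  "q \<in> facts D \<Longrightarrow> (defeasibly q \<Leftarrow> {}) \<in> ground_common \<Sigma> D"
  "r \<in> strict_rules G \<Longrightarrow> (definitely (consequent r) \<Leftarrow> {Is (body_Delta r)}) \<in> ground_common \<Sigma> D"
  "r \<in> strict_rules G \<Longrightarrow> (lambda (consequent r) \<Leftarrow> {Is (body_Delta r)}) \<in> ground_common \<Sigma> D"
  "r \<in> strict_rules G \<Longrightarrow> (defeasibly (consequent r) \<Leftarrow> {Is (body_Delta r)}) \<in> ground_common \<Sigma> D"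
  "r \<in> strict_rules G \<Longrightarrow>
    (body_Delta r \<Leftarrow> (\<lambda>\<alpha>. Is (definitely \<alpha>)) ` antecedent r) \<in> ground_common \<Sigma> D"
  "r \<in> sd_rules G \<Longrightarrow>
    (lambda (consequent r) \<Leftarrow> {Naf (definitely (compl (consequent r))), Is (body_lambda r)})
      \<in> ground_common \<Sigma> D"
  "r \<in> rules G \<Longrightarrow> (body_lambda r \<Leftarrow> (\<lambda>\<alpha>. Is (lambda \<alpha>)) ` antecedent r) \<in> ground_common \<Sigma> D"
  "r \<in> rules G \<Longrightarrow> (body_d r \<Leftarrow> (\<lambda>\<alpha>. Is (defeasibly \<alpha>)) ` antecedent r) \<in> ground_common \<Sigma> D"
  using instances_weak[of r \<Sigma> "strict_rules D"] instances_weak[of r \<Sigma> "sd_rules D"]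
  by (simp_all add: ground_common_def) blast+

lemma common_cases [consumes 1, case_names fact strict body_Delta lambda body_lambda body_d]:
  assumes "c \<in> ground_common \<Sigma> D"
  obtains q where "q \<in> facts D" "head c \<in> {definitely q, lambda q, defeasibly q}"
  | w where "w \<in> weak_instances \<Sigma> (strict_rules D)" "body c = {Is (body_Delta w)}"
      "head c \<in> {definitely (consequent w), lambda (consequent w), defeasibly (consequent w)}"
  | r where "r \<in> strict_rules G" "head c = body_Delta r"
      "body c = (\<lambda>\<alpha>. Is (definitely \<alpha>)) ` antecedent r"
  | w where "w \<in> weak_instances \<Sigma> (sd_rules D)" "head c = lambda (consequent w)"
      "body c = {Naf (definitely (compl (consequent w))), Is (body_lambda w)}"
  | r where "r \<in> rules G" "head c = body_lambda r"
      "body c = (\<lambda>\<alpha>. Is (lambda \<alpha>)) ` antecedent r"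
  | r where "r \<in> rules G" "head c = body_d r"
      "body c = (\<lambda>\<alpha>. Is (defeasibly \<alpha>)) ` antecedent r"
  using assms unfolding ground_common_def by (elim UnE CollectE exE conjE) auto

lemma common_not_conflict: "c \<in> ground_common \<Sigma> D \<Longrightarrow> \<not> in_conflict (pred (head c))"
  by (erule common_cases; (elim insertE emptyE)?; simp)

end

text \<open>Neither compiled program adds a clause with a base head, so both give the base layer the
  same truth values. This is proved once here.\<close>

locale program_over = compilation \<Sigma> D
  for \<Sigma> :: "('f \<times> nat) set" and D :: "('p, 'f, 'v) dtheory" +
  fixes P :: "('p, 'f, 'v) patom clause set"
  assumes common_subset: "ground_common \<Sigma> D \<subseteq> P"
    and base_clause: "c \<in> P \<Longrightarrow> in_base (pred (head c)) \<Longrightarrow> c \<in> ground_common \<Sigma> D"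
begin

section \<open>Truth values of the base layer in the well-founded model\<close>

lemma common_model:
  "(a \<Leftarrow> B) \<in> ground_common \<Sigma> D \<Longrightarrow> B \<subseteq> wf_model P \<Longrightarrow> Is a \<in> wf_model P"
  using wf_model_Is[of "a \<Leftarrow> B" P] common_subset by auto

lemma definitely_model: "q \<in> P_Delta G \<Longrightarrow> Is (definitely q) \<in> wf_model P"
proof (induction rule: P_Delta.induct)
  case (fact q)
  then show ?case
    using common_model[OF common_intros(1)] by auto
next
  case (strict r q)
  have "Is (body_Delta r) \<in> wf_model P"
    by (rule common_model[OF common_intros(7)[OF strict(1)]]) (use strict in auto)
  then show ?case
    using common_model[OF common_intros(4)[OF strict(1)]] strict(2) by auto
qed

lemma body_Delta_model:
  assumes "r \<in> strict_rules G" "antecedent r \<subseteq> P_Delta G"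
  shows "Is (body_Delta r) \<in> wf_model P"
  by (rule common_model[OF common_intros(7)[OF assms(1)]]) (use assms definitely_model in auto)

text \<open>The clauses for these atoms contain no negation. The complement of their least model is
  therefore unfounded relative to any interpretation, and every clause is refuted by a positive body
  atom inside the set.\<close>

lemma Delta_false_model:
  assumes "a \<notin> base_true" "pred a \<in> range Definitely \<union> range BodyDelta"
  shows "Naf a \<in> wf_model P"
proof (rule wf_model_Naf)
  let ?U = "{a. a \<notin> base_true \<and> pred a \<in> range Definitely \<union> range BodyDelta}"
  show "a \<in> ?U"
    using assms by simp
  show "unfounded P (wf_model P) ?U"
    unfolding unfounded_def
  proof (intro ballI impI disjI2)
    fix c assume c: "c \<in> P" "head c \<in> ?U"
    then have "c \<in> ground_common \<Sigma> D"
      by (auto intro: base_clause)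
    then show "\<exists>a\<in>?U. Is a \<in> body c"
    proof (cases rule: common_cases)
      case (fact q)
      then show ?thesis
        using c P_Delta.fact[of q G] by auto
    next
      case (strict w)
      then show ?thesis
        using c body_Delta_base_trueD by auto
    next
      case (body_Delta r)
      then have "body_Delta r \<notin> base_true"
        using c(2) by simp
      then obtain \<alpha> where "\<alpha> \<in> antecedent r" "\<alpha> \<notin> P_Delta G"
        using body_Delta_base_trueI[OF body_Delta(1)] by blast
      then show ?thesis
        using body_Delta by (intro bexI[of _ "definitely \<alpha>"]) auto
    qed (use c in auto)
  qed
qed

lemma lambda_model: "q \<in> P_lambda G \<Longrightarrow> Is (lambda q) \<in> wf_model P"
proof (induction rule: P_lambda.induct)
  case (Delta q)
  then show ?case
  proof cases
    case fact
    then show ?thesis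
      using common_model[OF common_intros(2)] by auto
  next
    case (strict r)
    then show ?thesis
      using common_model[OF common_intros(5)[OF strict(1)]] body_Delta_model[of r] by auto
  qed
next
  case (rule r q)
  have "r \<in> rules G"
    using rule(1) sd_rules_subset by blast
  then have "Is (body_lambda r) \<in> wf_model P"
    by (rule common_model[OF common_intros(9)]) (use rule in auto)
  moreover have "Naf (definitely (compl q)) \<in> wf_model P"
    by (rule Delta_false_model) (use rule in auto)
  ultimately show ?case
    using common_model[OF common_intros(8)[OF rule(1)]] rule(2) by auto
qed

text \<open>This is the next stratum: the set is unfounded only relative to an interpretation that
  already decides the strict layer. A clause is either blocked by a decided strict atom or has a
  positive body atom in the set.\<close>

lemma lambda_false_model:
  assumes "a \<notin> base_true" "pred a \<in> range Lambda \<union> range BodyLambda"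
  shows "Naf a \<in> wf_model P"
proof (rule wf_model_Naf)
  let ?U = "{a. a \<notin> base_true \<and> pred a \<in> range Lambda \<union> range BodyLambda}"
  show "a \<in> ?U"
    using assms by simp
  show "unfounded P (wf_model P) ?U"
    unfolding unfounded_def
  proof (intro ballI impI)
    fix c assume c: "c \<in> P" "head c \<in> ?U"
    then have "c \<in> ground_common \<Sigma> D"
      by (auto intro: base_clause)
    then show "(\<exists>l\<in>body c. plit_compl l \<in> wf_model P) \<or> (\<exists>a\<in>?U. Is a \<in> body c)"
    proof (cases rule: common_cases)
      case (fact q)
      then show ?thesis
        using c P_lambda.Delta[OF P_Delta.fact, of q G] by auto
    next
      case (strict w)
      have "consequent w \<notin> P_lambda G"
        using c(2) strict(3) by auto
      then have "consequent w \<notin> P_Delta G"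
        by (metis P_lambda.Delta)
      \<comment> \<open>The atom \<open>body_Delta w\<close> lies outside \<open>?U\<close> because
        of its predicate, so the clause has to be blocked by its falsity in the model.\<close>
      then have "body_Delta w \<notin> base_true"
        using body_Delta_base_trueD[OF _ strict(1)] by metis
      then show ?thesis
        using strict(2) Delta_false_model[of "body_Delta w"] by auto
    next
      case (lambda w)
      have *: "consequent w \<notin> P_lambda G"
        using c(2) lambda(2) by auto
      show ?thesis
      proof (cases "compl (consequent w) \<in> P_Delta G")
        case True
        then show ?thesis
          using definitely_model lambda(3) by auto
      next
        case False
        then have "body_lambda w \<notin> base_true"
          using * body_lambda_base_trueD[OF _ lambda(1)] by metis
        then show ?thesis
          using lambda(3) by auto
      qed
    next
      case (body_lambda r)
      then have "body_lambda r \<notin> base_true"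
        using c(2) by simp
      then obtain \<alpha> where "\<alpha> \<in> antecedent r" "\<alpha> \<notin> P_lambda G"
        using body_lambda_base_trueI[OF body_lambda(1)] by blast
      then show ?thesis
        using body_lambda by (intro disjI2 bexI[of _ "lambda \<alpha>"]) auto
    qed (use c in auto)
  qed
qed

lemma defeasibly_Delta_model:
  assumes "q \<in> P_Delta G"
  shows "Is (defeasibly q) \<in> wf_model P"
  using assms
proof cases
  case fact
  then show ?thesis
    using common_model[OF common_intros(3)] by auto
next
  case (strict r)
  then show ?thesis
    using common_model[OF common_intros(6)[OF strict(1)]] body_Delta_model[of r] by auto
qed

lemma body_d_model:
  assumes "r \<in> rules G" "\<forall>\<alpha>\<in>antecedent r. Is (defeasibly \<alpha>) \<in> wf_model P"
  shows "Is (body_d r) \<in> wf_model P"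
  by (rule common_model[OF common_intros(10)[OF assms(1)]]) (use assms in auto)

section \<open>A family of prefixpoints\<close>

text \<open>The prefixpoint may be inconsistent: above the base layer every atom that is not of the form
  \<open>overruled\<close> is declared false, and \<open>T\<close> will contain every atom of that form. Then only
  the falsity of the \<open>overruled\<close> atoms, collected in \<open>F\<close>, remains to be controlled.\<close>

definition prefixpoint ::
    "('p, 'f, 'v) lit set \<Rightarrow> ('p, 'f, 'v) patom set \<Rightarrow> ('p, 'f, 'v) patom set \<Rightarrow>
      ('p, 'f, 'v) patom plit set" where
  "prefixpoint Q T F =
     Is ` (base_true \<union> defeasibly ` Q \<union> {body_d r | r. r \<in> rules G \<and> antecedent r \<subseteq> Q} \<union>
       {a \<in> T. in_conflict (pred a)}) \<union>
     Naf ` ({a. in_base (pred a) \<and> a \<notin> base_true} \<union>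
       {a. \<not> in_base (pred a) \<and> \<not> is_overruled (pred a)} \<union> {a \<in> F. is_overruled (pred a)})"

lemma base_true_in_base: "a \<in> base_true \<Longrightarrow> in_base (pred a)"
  by (auto simp: base_true_def)

lemma Is_base_prefixpoint: "in_base (pred a) \<Longrightarrow> Is a \<in> prefixpoint Q T F \<longleftrightarrow> a \<in> base_true"
  by (cases "pred a") (auto simp: prefixpoint_def)

lemma Naf_base_prefixpoint: "in_base (pred a) \<Longrightarrow> Naf a \<in> prefixpoint Q T F \<longleftrightarrow> a \<notin> base_true"
  by (cases "pred a") (auto simp: prefixpoint_def)

lemma Is_defeasibly_prefixpoint: "Is (defeasibly q) \<in> prefixpoint Q T F \<longleftrightarrow> q \<in> Q"
  by (auto simp: prefixpoint_def dest: base_true_in_base arg_cong[where f = pred])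

lemma Is_body_d_prefixpoint:
  "Is (body_d w) \<in> prefixpoint Q T F \<longleftrightarrow>
    (\<exists>r. body_d w = body_d r \<and> r \<in> rules G \<and> antecedent r \<subseteq> Q)"
  by (auto simp: prefixpoint_def dest: base_true_in_base arg_cong[where f = pred])

lemma Is_conflict_prefixpoint: "in_conflict (pred a) \<Longrightarrow> Is a \<in> prefixpoint Q T F \<longleftrightarrow> a \<in> T"
  by (cases "pred a") (auto simp: prefixpoint_def dest: base_true_in_base)

lemma Naf_overruled_prefixpoint: "is_overruled (pred a) \<Longrightarrow> Naf a \<in> prefixpoint Q T F \<longleftrightarrow> a \<in> F"
  by (cases "pred a") (auto simp: prefixpoint_def)

lemmas prefixpoint_simps = Is_base_prefixpoint Naf_base_prefixpoint Is_defeasibly_prefixpoint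
  Is_body_d_prefixpoint Is_conflict_prefixpoint Naf_overruled_prefixpoint

lemma Is_body_d_prefixpointE:
  assumes "Is (body_d w) \<in> prefixpoint Q T F" "w \<in> weak_instances \<Sigma> (sd_rules D)"
  obtains r where "r \<in> sd_rules G" "\<forall>\<alpha>\<in>antecedent r. \<alpha> \<in> Q"
    "label w = label r" "consequent w = consequent r"
proof -
  obtain r where r: "body_d w = body_d r" "r \<in> rules G" "antecedent r \<subseteq> Q"
    using assms(1) by (auto simp: Is_body_d_prefixpoint)
  have "label w = label r \<and> consequent w = consequent r \<and> kind w = kind r"
    using body_unique[OF conjunct1[OF weak_sd[OF assms(2)]] r(2)] r(1) by blast
  then show ?thesis
    using that[of r] r sd_rulesI weak_sd[OF assms(2)] by auto
qed

text \<open>On base heads this is the closure of \<open>base_true\<close> under the clauses. The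
  premise \<open>P_Delta G \<subseteq> Q\<close> is for the \<open>defeasibly\<close> clauses of
  facts and strict rules.\<close>

lemma common_immediate:
  assumes "P_Delta G \<subseteq> Q" "c \<in> ground_common \<Sigma> D" "body c \<subseteq> prefixpoint Q T F"
  shows "Is (head c) \<in> prefixpoint Q T F"
  using assms(2)
proof (cases rule: common_cases)
  case (fact q)
  then have "q \<in> P_Delta G"
    using P_Delta.fact[of q G] by simp
  then show ?thesis
    using fact(2) assms(1) P_lambda.Delta[of q G] by (auto simp: prefixpoint_simps)
next
  case (strict w)
  then have "body_Delta w \<in> base_true"
    using assms(3) by (simp add: prefixpoint_simps)
  then have "consequent w \<in> P_Delta G"
    using body_Delta_base_trueD strict(1) by metis
  then have "consequent w \<in> P_lambda G" "consequent w \<in> Q"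
    using assms(1) P_lambda.Delta by blast+
  then show ?thesis
    using strict(3) \<open>consequent w \<in> P_Delta G\<close> by (elim insertE) (simp_all add: prefixpoint_simps)
next
  case (body_Delta r)
  have "Is (definitely \<alpha>) \<in> prefixpoint Q T F" if "\<alpha> \<in> antecedent r" for \<alpha>
    using assms(3) that unfolding body_Delta(3) by blast
  then have "antecedent r \<subseteq> P_Delta G"
    by (auto simp: prefixpoint_simps)
  then have "body_Delta r \<in> base_true"
    using body_Delta_base_trueI body_Delta(1) by metis
  then show ?thesis
    by (simp add: body_Delta(2) prefixpoint_simps)
next
  case (lambda w)
  then have "consequent w \<in> P_lambda G"
    using assms(3) body_lambda_base_trueD[of w] by (simp add: prefixpoint_simps)
  then show ?thesis
    by (simp add: lambda(2) prefixpoint_simps)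
next
  case (body_lambda r)
  have "Is (lambda \<alpha>) \<in> prefixpoint Q T F" if "\<alpha> \<in> antecedent r" for \<alpha>
    using assms(3) that unfolding body_lambda(3) by blast
  then have "antecedent r \<subseteq> P_lambda G"
    by (auto simp: prefixpoint_simps)
  then have "body_lambda r \<in> base_true"
    using body_lambda_base_trueI body_lambda(1) by metis
  then show ?thesis
    by (simp add: body_lambda(2) prefixpoint_simps)
next
  case (body_d r)
  have "Is (defeasibly \<alpha>) \<in> prefixpoint Q T F" if "\<alpha> \<in> antecedent r" for \<alpha>
    using assms(3) that unfolding body_d(3) by blast
  then have "antecedent r \<subseteq> Q"
    by (auto simp: prefixpoint_simps)
  then show ?thesis
    using body_d(1,2) Is_body_d_prefixpoint by metis
qed

lemma unfounded_clause:
  "unfounded P I U \<Longrightarrow> (a \<Leftarrow> B) \<in> P \<Longrightarrow> a \<in> U \<Longrightarrow>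
    (\<exists>l\<in>B. plit_compl l \<in> I) \<or> (\<exists>b\<in>U. Is b \<in> B)"
  unfolding unfounded_def by fastforce

text \<open>On base atoms the interpretation is exact and consistent, so it contradicts no literal
  of a clause that derives an atom of \<open>base_true\<close>. Unfoundedness would then pass from
  the head to a positive body atom, down the whole derivation, and end at a fact or an empty
  body.\<close>

lemma unfounded_base_true:
  assumes "unfounded P (prefixpoint Q T F) U" "a \<in> U"
  shows "a \<notin> base_true"
proof -
  note clause = unfounded_clause[OF assms(1) subsetD[OF common_subset]]
  have 1: "definitely q \<notin> U" if "q \<in> P_Delta G" for q
    using that
  proof (induction rule: P_Delta.induct)
    case (fact q)
    then show ?case
      using clause[OF common_intros(1)] by auto
  next
    case (strict r q)
    then have "body_Delta r \<in> base_true"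
      by (auto intro: body_Delta_base_trueI)
    \<comment> \<open>Truth of the body atom excludes that the clause is blocked; its absence from
      \<open>U\<close> excludes the other alternative.\<close>
    moreover have "body_Delta r \<notin> U"
      using clause[OF common_intros(7)[OF strict(1)]] strict by (auto simp: prefixpoint_simps)
    ultimately show ?case
      using clause[OF common_intros(4)[OF strict(1)]] strict(2) by (auto simp: prefixpoint_simps)
  qed
  have 2: "body_Delta r \<notin> U" if "r \<in> strict_rules G" "antecedent r \<subseteq> P_Delta G" for r
    using clause[OF common_intros(7)[OF that(1)]] 1 that by (auto simp: prefixpoint_simps)
  have 3: "lambda q \<notin> U" if "q \<in> P_lambda G" for q
    using that
  proof (induction rule: P_lambda.induct)
    case (Delta q)
    then show ?case
    proof cases
      case fact
      then show ?thesis
        using clause[OF common_intros(2)] by auto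
    next
      case (strict r)
      then have "body_Delta r \<in> base_true" "body_Delta r \<notin> U"
        using body_Delta_base_trueI[of r] 2[of r] by auto
      then show ?thesis
        using clause[OF common_intros(5)[OF strict(1)]] strict(2) by (auto simp: prefixpoint_simps)
    qed
  next
    case (rule r q)
    have r: "r \<in> rules G"
      using rule(1) sd_rules_subset by blast
    then have "body_lambda r \<in> base_true"
      using rule by (auto intro: body_lambda_base_trueI)
    moreover have "body_lambda r \<notin> U"
      using clause[OF common_intros(9)[OF r]] rule by (auto simp: prefixpoint_simps)
    ultimately show ?case
      using clause[OF common_intros(8)[OF rule(1)]] rule by (auto simp: prefixpoint_simps)
  qed
  have 4: "body_lambda r \<notin> U" if "r \<in> rules G" "antecedent r \<subseteq> P_lambda G" for r
    using clause[OF common_intros(9)[OF that(1)]] 3 that by (auto simp: prefixpoint_simps)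
  show ?thesis
    using assms(2) 1 2 3 4 by (auto simp: base_true_def)
qed

text \<open>Everything common to both programs is discharged here. The disjointness from
  \<open>base_true\<close> is passed on because an unfounded set may refute an attack through
  \<open>body_lambda s\<close>, which then has to be untrue.\<close>

lemma wf_model_prefixpoint:
  assumes "P_Delta G \<subseteq> Q"
    and "\<And>c. c \<in> P \<Longrightarrow> c \<notin> ground_common \<Sigma> D \<Longrightarrow> body c \<subseteq> prefixpoint Q T F \<Longrightarrow>
      Is (head c) \<in> prefixpoint Q T F"
    and "\<And>U a. unfounded P (prefixpoint Q T F) U \<Longrightarrow> U \<inter> base_true = {} \<Longrightarrow> a \<in> U \<Longrightarrow>
      is_overruled (pred a) \<Longrightarrow> a \<in> F"
  shows "wf_model P \<subseteq> prefixpoint Q T F"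
proof (rule wf_model_subset)
  fix U a assume U: "unfounded P (prefixpoint Q T F) U" "a \<in> U"
  then have "U \<inter> base_true = {}"
    using unfounded_base_true by blast
  then show "Naf a \<in> prefixpoint Q T F"
    using assms(3)[OF U(1) _ U(2)] U(2) by (auto simp: prefixpoint_def)
next
  fix c assume "c \<in> P" "body c \<subseteq> prefixpoint Q T F"
  then show "Is (head c) \<in> prefixpoint Q T F"
    using assms(1,2) common_immediate by blast
qed

end

section \<open>The two compiled programs\<close>

context compilation
begin

interpretation S: program_over \<Sigma> D "ground_S \<Sigma> D"
  by unfold_locales (auto simp: ground_S_def)

interpretation S_star: program_over \<Sigma> D "ground_S_star \<Sigma> D"
  by unfold_locales (auto simp: ground_S_star_def)

section \<open>The program for \<open>P_partial\<close>\<close>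

lemma ground_rule_origin:
  assumes "r \<in> rules G"
  obtains r' where "r' \<in> rules D" "label r' = label r"
    "name (consequent r') = name (consequent r)"
  using assms by (auto simp: instances_over_def)

lemma S_defeasibly_clause: "r \<in> sd_rules G \<Longrightarrow>
    (defeasibly (consequent r) \<Leftarrow>
      {Naf (definitely (compl (consequent r))), Is (body_d r), Naf (overruled (consequent r))})
      \<in> ground_S \<Sigma> D"
  using instances_weak[of r \<Sigma> "sd_rules D"] by (simp add: ground_S_def) blast

lemma S_overruled_clause: "s \<in> rules G \<Longrightarrow>
    (overruled (compl (consequent s)) \<Leftarrow>
      {Is (body_lambda s), Naf (defeated (label s) (consequent s))}) \<in> ground_S \<Sigma> D"
  using instances_weak[of s \<Sigma> "rules D"] by (simp add: ground_S_def) blast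

text \<open>The clause is generated from the uninstantiated rule behind \<open>s\<close>. It carries
  the arguments of \<open>t\<close>, which are those of \<open>s\<close> because the two consequents
  are complementary.\<close>

lemma S_defeated_clause:
  assumes "t \<in> sd_rules G" "s \<in> rules G" "consequent s = compl (consequent t)"
    and "(label t, label s) \<in> superior D"
  shows "(defeated (label s) (consequent s) \<Leftarrow> {Is (body_d t)}) \<in> ground_S \<Sigma> D"
proof -
  obtain s' where s': "s' \<in> rules D" "label s' = label s"
    "name (consequent s') = compl (name (consequent t))"
    using ground_rule_origin[OF assms(2)] assms(3) by (metis name_compl)
  have "t \<in> weak_instances \<Sigma> (sd_rules D)"
    using assms(1) instances_weak by auto
  with s' assms(4) have "(defeated (label s') (compl (consequent t)) \<Leftarrow> {Is (body_d t)}) \<in> ground_S \<Sigma> D"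
    unfolding ground_S_def by (intro UnI2 CollectI exI[of _ t] exI[of _ s']) auto
  then show ?thesis
    using s'(2) assms(3) by simp
qed

lemma S_cases [consumes 1, case_names common defeasibly overruled defeated]:
  assumes "c \<in> ground_S \<Sigma> D"
  obtains "c \<in> ground_common \<Sigma> D"
  | w where "w \<in> weak_instances \<Sigma> (sd_rules D)" "head c = defeasibly (consequent w)"
      "body c = {Naf (definitely (compl (consequent w))), Is (body_d w), Naf (overruled (consequent w))}"
  | w where "w \<in> weak_instances \<Sigma> (rules D)" "head c = overruled (compl (consequent w))"
      "body c = {Is (body_lambda w), Naf (defeated (label w) (consequent w))}"
  | w l where "w \<in> weak_instances \<Sigma> (sd_rules D)" "(label w, l) \<in> superior D"
      "head c = defeated l (compl (consequent w))" "body c = {Is (body_d w)}"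
  using assms unfolding ground_S_def by (elim UnE CollectE exE conjE) auto

lemma S_defeasibly_model:
  "q \<in> P_partial G \<Longrightarrow> Is (defeasibly q) \<in> wf_model (ground_S \<Sigma> D)"
proof (induction rule: P_partial.induct)
  case (Delta q)
  then show ?case
    by (rule S.defeasibly_Delta_model)
next
  case (rule r q)
  let ?M = "wf_model (ground_S \<Sigma> D)"
  have "r \<in> rules G"
    using rule(1) sd_rules_subset by blast
  then have "Is (body_d r) \<in> ?M"
    by (rule S.body_d_model) (use rule.IH(1) in auto)
  moreover have "Naf (definitely (compl q)) \<in> ?M"
    by (rule S.Delta_false_model) (use rule.hyps(3) in auto)
  moreover have "Naf (overruled q) \<in> ?M"
  proof (rule wf_model_Naf)
    show "overruled q \<in> {overruled q}"
      by simp
    show "unfounded (ground_S \<Sigma> D) ?M {overruled q}"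
      unfolding unfounded_def
    proof (intro ballI impI disjI1)
      fix c assume c: "c \<in> ground_S \<Sigma> D" "head c \<in> {overruled q}"
      then have head: "pred (head c) = Overruled (name q)"
        by simp
      from c(1) show "\<exists>l\<in>body c. plit_compl l \<in> ?M"
      proof (cases rule: S_cases)
        case common
        then show ?thesis
          using common_not_conflict[OF common] c(2) by simp
      next
        case (overruled w)
        then have w: "consequent w = compl q"
          using c(2) by auto
        show ?thesis
        proof (cases "body_lambda w \<in> base_true")
          case False
          then have "Naf (body_lambda w) \<in> ?M"
            by (intro S.lambda_false_model) auto
          then show ?thesis
            using overruled(3) by auto
        next
          case True
          \<comment> \<open>The attack condition is applied to the instance \<open>s\<close> that
            makes the body atom true, not to \<open>w\<close>. The antecedent of \<open>s\<close>
            lies in \<open>P_lambda G\<close>, so only the alternative with a superior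
            \<open>t\<close> remains, and the induction hypothesis makes the antecedent of
            \<open>t\<close> true.\<close>
          then obtain s where s: "s \<in> rules G" "antecedent s \<subseteq> P_lambda G"
            "label w = label s" "consequent w = consequent s"
            using body_lambda_base_trueE[OF True overruled(1)] by metis
          then obtain t where t: "t \<in> sd_rules G" "consequent t = q"
            "\<forall>\<alpha>\<in>antecedent t. Is (defeasibly \<alpha>) \<in> ?M" "(label t, label s) \<in> superior D"
            using rule.IH(2) w by auto
          have "t \<in> rules G"
            using t(1) sd_rules_subset by blast
          then have "Is (body_d t) \<in> ?M"
            using t(3) by (rule S.body_d_model)
          moreover have "(defeated (label s) (consequent s) \<Leftarrow> {Is (body_d t)}) \<in> ground_S \<Sigma> D"
            using S_defeated_clause[OF t(1) s(1) _ t(4)] t(2) s(4) w by simp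
          ultimately have "Is (defeated (label s) (consequent s)) \<in> ?M"
            using wf_model_Is by fastforce
          then show ?thesis
            using overruled(3) s by auto
        qed
      qed (use head in simp_all)
    qed
  qed
  ultimately show ?case
    using wf_model_Is[OF S_defeasibly_clause[OF rule(1)]] rule(2) by auto
qed

text \<open>\<open>?F\<close> is the premise on attackers in \<open>P_partial.rule\<close>; it is
  vacuous for atoms not of the form \<open>overruled q\<close>. \<open>?T\<close> admits
  \<open>defeated\<close> only with support in \<open>P_partial G\<close>, since its truth is what
  allows an \<open>overruled\<close> atom to be unfounded.\<close>

lemma S_model_subset:
  "wf_model (ground_S \<Sigma> D) \<subseteq> S.prefixpoint (P_partial G)
     ({a. is_overruled (pred a)} \<union>
      {defeated l (compl (consequent t)) | t l. t \<in> sd_rules G \<and>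
         (\<forall>\<alpha>\<in>antecedent t. \<alpha> \<in> P_partial G) \<and> (label t, l) \<in> superior D})
     {a. \<forall>q. a = overruled q \<longrightarrow> (\<forall>s\<in>rules G. consequent s = compl q \<longrightarrow>
        (\<exists>\<alpha>\<in>antecedent s. \<alpha> \<notin> P_lambda G) \<or>
        (\<exists>t\<in>sd_rules G. consequent t = q \<and> (\<forall>\<alpha>\<in>antecedent t. \<alpha> \<in> P_partial G) \<and>
           (label t, label s) \<in> superior D))}"
  (is "_ \<subseteq> S.prefixpoint ?Q ?T ?F")
proof (rule S.wf_model_prefixpoint)
  show "P_Delta G \<subseteq> ?Q"
    by (auto intro: P_partial.Delta)
next
  fix c assume c: "c \<in> ground_S \<Sigma> D" "c \<notin> ground_common \<Sigma> D" "body c \<subseteq> S.prefixpoint ?Q ?T ?F"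
  from c(1) show "Is (head c) \<in> S.prefixpoint ?Q ?T ?F"
  proof (cases rule: S_cases)
    case common
    then show ?thesis
      using c(2) by contradiction
  next
    case (defeasibly w)
    have *: "Naf (definitely (compl (consequent w))) \<in> S.prefixpoint ?Q ?T ?F"
      "Is (body_d w) \<in> S.prefixpoint ?Q ?T ?F"
      "Naf (overruled (consequent w)) \<in> S.prefixpoint ?Q ?T ?F"
      using c(3) unfolding defeasibly(3) by simp_all
    obtain r where r: "r \<in> sd_rules G" "\<forall>\<alpha>\<in>antecedent r. \<alpha> \<in> ?Q" "consequent w = consequent r"
      using S.Is_body_d_prefixpointE[OF *(2) defeasibly(1)] by metis
    have "overruled (consequent w) \<in> ?F"
      using *(3) S.Naf_overruled_prefixpoint[of "overruled (consequent w)"] by simp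
    moreover have "compl (consequent w) \<notin> P_Delta G"
      using *(1) S.Naf_base_prefixpoint[of "definitely (compl (consequent w))"] by simp
    ultimately have "consequent w \<in> ?Q"
      by (intro P_partial.rule[OF r(1) r(3)[symmetric] r(2)]) simp_all
    then show ?thesis
      unfolding defeasibly(2) S.Is_defeasibly_prefixpoint .
  next
    case (overruled w)
    then show ?thesis
      using S.Is_conflict_prefixpoint[of "head c"] by simp
  next
    case (defeated w l)
    have "Is (body_d w) \<in> S.prefixpoint ?Q ?T ?F"
      using c(3) unfolding defeated(4) by simp
    from S.Is_body_d_prefixpointE[OF this defeated(1)]
    obtain t where t: "t \<in> sd_rules G" "\<forall>\<alpha>\<in>antecedent t. \<alpha> \<in> ?Q" "label w = label t"
      "consequent w = consequent t" .
    then have "head c \<in> ?T"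
      using defeated(2,3) by (intro UnI2 CollectI exI[of _ t] exI[of _ l]) simp
    then show ?thesis
      using defeated(3) S.Is_conflict_prefixpoint[of "head c" ?Q ?T ?F] by simp
  qed
next
  fix U a assume U: "unfounded (ground_S \<Sigma> D) (S.prefixpoint ?Q ?T ?F) U" "U \<inter> base_true = {}" "a \<in> U"
  show "a \<in> ?F"
  proof (intro CollectI allI impI ballI)
    fix q s assume a: "a = overruled q" and s: "s \<in> rules G" "consequent s = compl q"
    \<comment> \<open>Each attacker \<open>s\<close> has a clause for \<open>overruled q\<close>,
      and unfoundedness must refute every one of them. The two body literals leave exactly three
      ways.\<close>
    from S_overruled_clause[OF s(1)] s(2)
    have "(overruled q \<Leftarrow> {Is (body_lambda s), Naf (defeated (label s) (compl q))}) \<in> ground_S \<Sigma> D"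
      by simp
    from S.unfounded_clause[OF U(1) this] U(3) a
    consider "Naf (body_lambda s) \<in> S.prefixpoint ?Q ?T ?F" | "body_lambda s \<in> U"
      | "Is (defeated (label s) (compl q)) \<in> S.prefixpoint ?Q ?T ?F"
      by auto
    then show "(\<exists>\<alpha>\<in>antecedent s. \<alpha> \<notin> P_lambda G) \<or>
      (\<exists>t\<in>sd_rules G. consequent t = q \<and> (\<forall>\<alpha>\<in>antecedent t. \<alpha> \<in> ?Q) \<and>
         (label t, label s) \<in> superior D)"
    proof cases
      case 1
      then have "body_lambda s \<notin> base_true"
        using S.Naf_base_prefixpoint[of "body_lambda s"] by simp
      then show ?thesis
        using body_lambda_base_trueI[OF s(1)] by blast
    next
      case 2
      then have "body_lambda s \<notin> base_true"
        using U(2) by blast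
      then show ?thesis
        using body_lambda_base_trueI[OF s(1)] by blast
    next
      case 3
      then have "defeated (label s) (compl q) \<in> ?T"
        using S.Is_conflict_prefixpoint[of "defeated (label s) (compl q)" ?Q ?T ?F] by simp
      then obtain t where t: "t \<in> sd_rules G" "\<forall>\<alpha>\<in>antecedent t. \<alpha> \<in> ?Q"
        "(label t, label s) \<in> superior D" "compl (consequent t) = compl q"
        by auto
      from t(4) have "consequent t = q"
        by (metis compl_compl)
      with t show ?thesis
        by blast
    qed
  qed
qed

lemma S_model:
  "Is (definitely q) \<in> wf_model (ground_S \<Sigma> D) \<longleftrightarrow> q \<in> P_Delta G"
  "Is (lambda q) \<in> wf_model (ground_S \<Sigma> D) \<longleftrightarrow> q \<in> P_lambda G"
  "Is (defeasibly q) \<in> wf_model (ground_S \<Sigma> D) \<longleftrightarrow> q \<in> P_partial G"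
  using subsetD[OF S_model_subset, of "Is (definitely q)"] subsetD[OF S_model_subset, of "Is (lambda q)"]
    subsetD[OF S_model_subset, of "Is (defeasibly q)"]
    S.definitely_model[of q] S.lambda_model[of q] S_defeasibly_model[of q]
  by (simp_all only: S.Is_base_prefixpoint S.Is_defeasibly_prefixpoint pred_patom in_base.simps
      definitely_base_true lambda_base_true) blast+

section \<open>The program for \<open>P_partial_star\<close>\<close>

lemma S_star_defeasibly_clause: "r \<in> sd_rules G \<Longrightarrow>
    (defeasibly (consequent r) \<Leftarrow>
      {Naf (definitely (compl (consequent r))), Is (body_d r),
       Naf (overruled_star (label r) (consequent r))}) \<in> ground_S_star \<Sigma> D"
  using instances_weak[of r \<Sigma> "sd_rules D"] by (simp add: ground_S_star_def) blast

lemma S_star_overruled_clause: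
  assumes "r \<in> sd_rules G" "s \<in> rules G" "consequent s = compl (consequent r)"
  shows "(overruled_star (label r) (consequent r) \<Leftarrow>
    {Is (body_lambda s), Naf (defeats (consequent r) (label r) (label s))}) \<in> ground_S_star \<Sigma> D"
proof -
  have "r \<in> instances \<Sigma> (sd_rules D)"
    using assms(1) by simp
  then obtain r' where r': "r' \<in> sd_rules D" "label r' = label r"
    "name (consequent r') = name (consequent r)"
    by (auto simp: instances_over_def)
  moreover have "s \<in> weak_instances \<Sigma> (rules D)"
    using assms(2) instances_weak by auto
  moreover have "name (consequent s) = compl (name (consequent r'))"
    using assms(3) r'(3) by simp
  ultimately have "(overruled_star (label r') (compl (consequent s)) \<Leftarrow>
      {Is (body_lambda s), Naf (defeats (consequent r') (label r') (label s))}) \<in> ground_S_star \<Sigma> D"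
    unfolding ground_S_star_def by blast
  \<comment> \<open>\<open>defeats\<close> retains only the name of its literal, so
    \<open>r'\<close> and its instance \<open>r\<close> yield the same atom.\<close>
  then show ?thesis
    using r' assms(3) by (simp add: defeats_def)
qed

lemma S_star_cases [consumes 1, case_names common defeasibly overruled defeats]:
  assumes "c \<in> ground_S_star \<Sigma> D"
  obtains "c \<in> ground_common \<Sigma> D"
  | w where "w \<in> weak_instances \<Sigma> (sd_rules D)" "head c = defeasibly (consequent w)"
      "body c = {Naf (definitely (compl (consequent w))), Is (body_d w),
        Naf (overruled_star (label w) (consequent w))}"
  | r w where "r \<in> sd_rules D" "w \<in> weak_instances \<Sigma> (rules D)"
      "head c = overruled_star (label r) (compl (consequent w))"
      "body c = {Is (body_lambda w), Naf (defeats (consequent r) (label r) (label w))}"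
  | r s where "r \<in> rules D" "s \<in> rules D" "(label r, label s) \<in> superior D"
      "head c = defeats (consequent r) (label r) (label s)"
  using assms unfolding ground_S_star_def by (elim UnE CollectE exE conjE) auto

lemma defeats_model:
  assumes "r \<in> rules D" "s \<in> rules G" "(label r, label s) \<in> superior D"
  shows "Is (defeats (consequent r) (label r) (label s)) \<in> wf_model (ground_S_star \<Sigma> D)"
proof -
  obtain s' where s': "s' \<in> rules D" "label s' = label s"
    using ground_rule_origin[OF assms(2)] by metis
  have "(defeats (consequent r) (label r) (label s) \<Leftarrow> {}) \<in> ground_S_star \<Sigma> D"
    unfolding ground_S_star_def
    by (intro UnI2 CollectI exI[of _ r] exI[of _ s']) (use s' assms(1,3) in simp)
  then show ?thesis
    using wf_model_Is by fastforce
qed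

lemma S_star_defeasibly_model:
  "q \<in> P_partial_star G \<Longrightarrow> Is (defeasibly q) \<in> wf_model (ground_S_star \<Sigma> D)"
proof (induction rule: P_partial_star.induct)
  case (Delta q)
  then show ?case
    by (rule S_star.defeasibly_Delta_model)
next
  case (rule r q)
  let ?M = "wf_model (ground_S_star \<Sigma> D)"
  have "r \<in> rules G"
    using rule(1) sd_rules_subset by blast
  then have "Is (body_d r) \<in> ?M"
    by (rule S_star.body_d_model) (use rule.IH in auto)
  moreover have "Naf (definitely (compl q)) \<in> ?M"
    by (rule S_star.Delta_false_model) (use rule.hyps(3) in auto)
  moreover have "Naf (overruled_star (label r) q) \<in> ?M"
  proof (rule wf_model_Naf)
    show "overruled_star (label r) q \<in> {overruled_star (label r) q}"
      by simp
    show "unfounded (ground_S_star \<Sigma> D) ?M {overruled_star (label r) q}"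
      unfolding unfounded_def
    proof (intro ballI impI disjI1)
      fix c assume c: "c \<in> ground_S_star \<Sigma> D" "head c \<in> {overruled_star (label r) q}"
      then have head: "pred (head c) = Overruled (name q)"
        by simp
      from c(1) show "\<exists>l\<in>body c. plit_compl l \<in> ?M"
      proof (cases rule: S_star_cases)
        case common
        then show ?thesis
          using common_not_conflict[OF common] c(2) by simp
      next
        case (overruled r' w)
        then have w: "label r' = label r" "consequent w = compl q"
          using c(2) by auto
        show ?thesis
        proof (cases "body_lambda w \<in> base_true")
          case False
          then have "Naf (body_lambda w) \<in> ?M"
            by (intro S_star.lambda_false_model) auto
          then show ?thesis
            using overruled(4) by auto
        next
          case True
          then obtain s where s: "s \<in> rules G" "antecedent s \<subseteq> P_lambda G"
            "label w = label s" "consequent w = consequent s"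
            using body_lambda_base_trueE[OF True overruled(2)] by metis
          then have "(label r', label s) \<in> superior D"
            using rule.hyps(4) w by auto
          moreover have "r' \<in> rules D"
            using overruled(1) sd_rules_subset by blast
          ultimately have "Is (defeats (consequent r') (label r') (label w)) \<in> ?M"
            using defeats_model s(1,3) by simp
          then show ?thesis
            using overruled(4) by auto
        qed
      qed (use head in simp_all)
    qed
  qed
  ultimately show ?case
    using wf_model_Is[OF S_star_defeasibly_clause[OF rule(1)]] rule(2) by auto
qed

text \<open>\<open>?T\<close> allows \<open>defeats\<close> with any literal, because only the pair
  of labels is read off again. \<open>?F\<close> ranges over all rule instances that share the given
  \<open>overruled_star\<close> atom.\<close>

lemma S_star_model_subset:
  "wf_model (ground_S_star \<Sigma> D) \<subseteq> S_star.prefixpoint (P_partial_star G)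
     ({a. is_overruled (pred a)} \<union> {defeats q l m | q l m. (l, m) \<in> superior D})
     {a. \<forall>r\<in>sd_rules G. a = overruled_star (label r) (consequent r) \<longrightarrow>
        (\<forall>s\<in>rules G. consequent s = compl (consequent r) \<longrightarrow>
          (\<exists>\<alpha>\<in>antecedent s. \<alpha> \<notin> P_lambda G) \<or> (label r, label s) \<in> superior D)}"
  (is "_ \<subseteq> S_star.prefixpoint ?Q ?T ?F")
proof (rule S_star.wf_model_prefixpoint)
  show "P_Delta G \<subseteq> ?Q"
    by (auto intro: P_partial_star.Delta)
next
  fix c assume c: "c \<in> ground_S_star \<Sigma> D" "c \<notin> ground_common \<Sigma> D"
    "body c \<subseteq> S_star.prefixpoint ?Q ?T ?F"
  from c(1) show "Is (head c) \<in> S_star.prefixpoint ?Q ?T ?F"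
  proof (cases rule: S_star_cases)
    case common
    then show ?thesis
      using c(2) by contradiction
  next
    case (defeasibly w)
    have *: "Naf (definitely (compl (consequent w))) \<in> S_star.prefixpoint ?Q ?T ?F"
      "Is (body_d w) \<in> S_star.prefixpoint ?Q ?T ?F"
      "Naf (overruled_star (label w) (consequent w)) \<in> S_star.prefixpoint ?Q ?T ?F"
      using c(3) unfolding defeasibly(3) by simp_all
    \<comment> \<open>Besides the consequent, the label has to be transferred from \<open>w\<close>
      to \<open>r\<close>: the starred condition compares the attackers with the supporting rule
      itself.\<close>
    obtain r where r: "r \<in> sd_rules G" "\<forall>\<alpha>\<in>antecedent r. \<alpha> \<in> ?Q" "label w = label r"
      "consequent w = consequent r"
      using S_star.Is_body_d_prefixpointE[OF *(2) defeasibly(1)] by metis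
    have "overruled_star (label r) (consequent r) \<in> ?F"
      using *(3) S_star.Naf_overruled_prefixpoint[of "overruled_star (label w) (consequent w)"] r(3,4)
      by simp
    then have "\<forall>s\<in>rules G. consequent s = compl (consequent r) \<longrightarrow>
        (\<exists>\<alpha>\<in>antecedent s. \<alpha> \<notin> P_lambda G) \<or> (label r, label s) \<in> superior D"
      using r(1) by blast
    moreover have "compl (consequent r) \<notin> P_Delta G"
      using *(1) S_star.Naf_base_prefixpoint[of "definitely (compl (consequent w))"] r(4) by simp
    ultimately have "consequent r \<in> ?Q"
      by (intro P_partial_star.rule[OF r(1) refl r(2)]) simp_all
    then show ?thesis
      unfolding defeasibly(2) S_star.Is_defeasibly_prefixpoint r(4) .
  next
    case (overruled r w)
    then show ?thesis
      using S_star.Is_conflict_prefixpoint[of "head c"] by simp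
  next
    case (defeats r s)
    then have "head c \<in> ?T"
      by blast
    then show ?thesis
      using defeats(4) S_star.Is_conflict_prefixpoint[of "head c" ?Q ?T ?F] by simp
  qed
next
  fix U a assume U: "unfounded (ground_S_star \<Sigma> D) (S_star.prefixpoint ?Q ?T ?F) U"
    "U \<inter> base_true = {}" "a \<in> U"
  show "a \<in> ?F"
  proof (intro CollectI ballI impI)
    fix r s assume r: "r \<in> sd_rules G" "a = overruled_star (label r) (consequent r)"
      and s: "s \<in> rules G" "consequent s = compl (consequent r)"
    from S_star.unfounded_clause[OF U(1) S_star_overruled_clause[OF r(1) s]] U(3) r(2)
    consider "Naf (body_lambda s) \<in> S_star.prefixpoint ?Q ?T ?F" | "body_lambda s \<in> U"
      | "Is (defeats (consequent r) (label r) (label s)) \<in> S_star.prefixpoint ?Q ?T ?F"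
      by auto
    then show "(\<exists>\<alpha>\<in>antecedent s. \<alpha> \<notin> P_lambda G) \<or> (label r, label s) \<in> superior D"
    proof cases
      case 1
      then have "body_lambda s \<notin> base_true"
        using S_star.Naf_base_prefixpoint[of "body_lambda s"] by simp
      then show ?thesis
        using body_lambda_base_trueI[OF s(1)] by blast
    next
      case 2
      then have "body_lambda s \<notin> base_true"
        using U(2) by blast
      then show ?thesis
        using body_lambda_base_trueI[OF s(1)] by blast
    next
      case 3
      then have "defeats (consequent r) (label r) (label s) \<in> ?T"
        using S_star.Is_conflict_prefixpoint[of "defeats (consequent r) (label r) (label s)" ?Q ?T ?F]
        by simp
      then show ?thesis
        by (auto simp: defeats_def)
    qed
  qed
qed

lemma S_star_model:
  "Is (defeasibly q) \<in> wf_model (ground_S_star \<Sigma> D) \<longleftrightarrow> q \<in> P_partial_star G"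
  using subsetD[OF S_star_model_subset, of "Is (defeasibly q)"] S_star_defeasibly_model[of q]
  by (simp only: S_star.Is_defeasibly_prefixpoint) blast

end

theorem theorem6:
  fixes \<Sigma> :: "('f \<times> nat) set"
    and D :: "('p, 'f, 'v) dtheory"
    and q :: "('p, 'f, 'v) lit"
  assumes "defeasible_theory \<Sigma> D"
    and "ground_lit \<Sigma> q"
  shows "(proves_Delta \<Sigma> D q \<longleftrightarrow> wf_entails \<Sigma> (S_program D) (Is (definitely q))) \<and>
         (proves_lambda \<Sigma> D q \<longleftrightarrow> wf_entails \<Sigma> (S_program D) (Is (lambda q))) \<and>
         (proves_partial \<Sigma> D q \<longleftrightarrow> wf_entails \<Sigma> (S_program D) (Is (defeasibly q))) \<and>
         (proves_partial_star \<Sigma> D q \<longleftrightarrow> wf_entails \<Sigma> (S_star_program D) (Is (defeasibly q)))"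
proof -
  interpret compilation \<Sigma> D
    by unfold_locales (rule assms(1))
  show ?thesis
    unfolding proves_Delta_def proves_lambda_def proves_partial_def proves_partial_star_def
      wf_entails_def ground_S_program[OF assms(1)] ground_S_star_program[OF assms(1)]
    by (simp only: S_model S_star_model)
qed

end
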